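(* Let $G$ be an abelian group, let $\mathcal{D}$ be a real algebra isomorphic to $M_n(\mathbb{C})$, $n=2^m$, and let $\Gamma$ be a division $G$-grading on $\mathcal{D}$ whose nonzero homogeneous components have real dimension $1$ and whose support $T$ is a group isomorphic to $\mathbb{Z}_2^{2m+1}$. Let $\beta$ (an alternating bicharacter of type II) and $\mu$ (a quadratic form with $\beta_\mu=\beta$ and $\mu(f_\beta)=-1$) be the maps determined by $\Gamma$ as in the context. Then the equation $\varphi(X_t)=\eta(t)X_t$ for all $t\in T$, $X_t\in\mathcal{D}_t$, gives a bijective correspondence between the involutions $\varphi$ of the graded algebra $\mathcal{D}$ and the quadratic forms $\eta:T\to\{\pm1\}$ with $\beta_\eta=\beta$, and the isomorphism class of the pair $(\Gamma,\varphi)$ is determined by the quadratic forms $\mu$ and $\eta$. Two such pairs $(\Gamma,\varphi)$ and $(\Gamma,\varphi')$, with corresponding quadratic forms $\eta$ and $\eta'$, are equivalent if and only if $\eta$ and $\eta'$ belong to the same one of the following four sets, into which the $2^{2m+1}$ quadratic forms $\eta$ are divided: (1) $\eta=\mu$; (2) $\eta(f_\beta)=-1$ but $\eta\neq\mu$; (3) $\eta(f_\beta)=+1$ and $\operatorname{Arf}(\eta)=+1$; (4) $\eta(f_\beta)=+1$ and $\operatorname{Arf}(\eta)=-1$.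
   Context: A grading on an algebra $\mathcal{D}$ by a group $G$ is a vector space decomposition $\mathcal{D}=\bigoplus_{g\in G}\mathcal{D}_g$ with $\mathcal{D}_g\mathcal{D}_h\subseteq\mathcal{D}_{gh}$. The support is the set of $g$ with $\mathcal{D}_g\neq0$. It is a division grading if every nonzero homogeneous element is invertible. An involution of the graded algebra $\mathcal{D}$ is a bijective $\mathbb{R}$-linear map $\varphi:\mathcal{D}\to\mathcal{D}$ with $\varphi(XY)=\varphi(Y)\varphi(X)$, $\varphi(\varphi(X))=X$ and $\varphi(\mathcal{D}_g)\subseteq\mathcal{D}_g$ for all $g$. If $\varphi,\varphi'$ are involutions on graded algebras $\mathcal{D},\mathcal{D}'$ with gradings $\Gamma,\Gamma'$, the pairs $(\Gamma,\varphi)$, $(\Gamma',\varphi')$ are isomorphic (respectively equivalent) if there is an isomorphism of real algebras $\psi:\mathcal{D}\to\mathcal{D}'$ with $\varphi'\psi=\psi\varphi$ and $\psi(\mathcal{D}_g)=\mathcal{D}'_g$ for all $g$ (respectively, for each $g$ in the support, $\psi(\mathcal{D}_g)=\mathcal{D}'_h$ for some $h$). An alternating bicharacter on $T$ is a map $\beta:T\times T\to\mathbb{R}\setminus\{0\}$ multiplicative in each variable with $\beta(u,u)=1$. Its radical is $\operatorname{rad}(\beta)=\{t\mid\beta(u,t)=1\ \forall u\in T\}$. It is of type II if $\operatorname{rad}(\beta)$ has exactly two elements, in which case $\operatorname{rad}(\beta)=\{e,f_\beta\}$. A quadratic form on $T$ is a map $\mu:T\to\{\pm1\}$ such that its polarization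 $\beta_\mu(u,v)=\mu(uv)\mu(u)^{-1}\mu(v)^{-1}$ is an alternating bicharacter. $\operatorname{Arf}(\mu)$ is $+1$, $-1$ or $0$ according to whether $\mu$ takes the value $+1$ more often than, less often than, or as often as $-1$. For $\Gamma$ as in the claim, $\beta$ and $\mu$ are defined by $X_uX_v=\beta(u,v)X_vX_u$ for $0\ne X_u\in\mathcal{D}_u$, $0\ne X_v\in\mathcal{D}_v$, and by requiring $X_t^2$ to be a positive real multiple of $\mu(t)1$ for $0\neq X_t\in\mathcal{D}_t$. *)

theory Defs
  imports "HOL-Analysis.Analysis" "HOL-Library.Z2" "HOL-Library.FuncSet"
    "HOL-Library.Disjoint_Sets"
begin

text \<open>
  Abelian groups are types of class \<open>ab_group_add\<close>, so the group operation is written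
  additively and the neutral element is \<open>0\<close>.  Real algebras are types of class
  \<open>real_algebra_1\<close>.  Maps with domain a subset \<open>T\<close> of the group that have to be compared
  (quadratic forms) are extensional functions; bicharacters are only ever evaluated on \<open>T\<close>.
\<close>

definition alg_iso :: "('a::real_algebra_1 \<Rightarrow> 'b::real_algebra_1) \<Rightarrow> bool" where
  "alg_iso \<psi> \<longleftrightarrow> linear \<psi> \<and> bij \<psi> \<and> \<psi> 1 = 1 \<and> (\<forall>x y. \<psi> (x * y) = \<psi> x * \<psi> y)"

text \<open>
  The product \<open>*\<close> on \<open>complex^'n^'n\<close> is componentwise, so \<^const>\<open>alg_iso\<close> does not apply to
  the matrix algebra, whose product is \<open>**\<close>.
\<close>
definition matrix_alg_iso :: "('a::real_algebra_1 \<Rightarrow> complex^'n^'n) \<Rightarrow> bool" where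
  "matrix_alg_iso \<psi> \<longleftrightarrow>
     linear \<psi> \<and> bij \<psi> \<and> \<psi> 1 = mat 1 \<and> (\<forall>x y. \<psi> (x * y) = \<psi> x ** \<psi> y)"

definition grading :: "('g::ab_group_add \<Rightarrow> 'a::real_algebra_1 set) \<Rightarrow> bool" where
  "grading \<Gamma> \<longleftrightarrow>
     (\<forall>g. subspace (\<Gamma> g)) \<and>
     (\<forall>x. \<exists>!c. (\<forall>g. c g \<in> \<Gamma> g) \<and> finite {g. c g \<noteq> 0} \<and> x = (\<Sum>g | c g \<noteq> 0. c g)) \<and>
     (\<forall>g h. \<forall>x\<in>\<Gamma> g. \<forall>y\<in>\<Gamma> h. x * y \<in> \<Gamma> (g + h))"

definition support :: "('g \<Rightarrow> 'a::real_algebra_1 set) \<Rightarrow> 'g set" where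
  "support \<Gamma> = {g. \<Gamma> g \<noteq> {0}}"

definition division_grading :: "('g::ab_group_add \<Rightarrow> 'a::real_algebra_1 set) \<Rightarrow> bool" where
  "division_grading \<Gamma> \<longleftrightarrow>
     grading \<Gamma> \<and> (\<forall>g. \<forall>x\<in>\<Gamma> g. x \<noteq> 0 \<longrightarrow> (\<exists>y. x * y = 1 \<and> y * x = 1))"

definition add_subgroup :: "'g::ab_group_add set \<Rightarrow> bool" where
  "add_subgroup T \<longleftrightarrow> 0 \<in> T \<and> (\<forall>s\<in>T. \<forall>t\<in>T. s + t \<in> T) \<and> (\<forall>t\<in>T. - t \<in> T)"

definition iso_Z2_power :: "nat \<Rightarrow> 'g::ab_group_add set \<Rightarrow> bool" where
  "iso_Z2_power k T \<longleftrightarrow>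
     (\<exists>f. bij_betw f T ({..<k} \<rightarrow>\<^sub>E (UNIV :: bit set)) \<and>
          (\<forall>s\<in>T. \<forall>t\<in>T. \<forall>i<k. f (s + t) i = f s i + f t i))"

definition onedim_division_grading ::
    "nat \<Rightarrow> ('g::ab_group_add \<Rightarrow> 'a::real_algebra_1 set) \<Rightarrow> bool" where
  "onedim_division_grading k \<Gamma> \<longleftrightarrow>
     division_grading \<Gamma> \<and> (\<forall>g\<in>support \<Gamma>. dim (\<Gamma> g) = 1) \<and>
     add_subgroup (support \<Gamma>) \<and> iso_Z2_power k (support \<Gamma>)"

definition graded_involutions :: "('g \<Rightarrow> 'a::real_algebra_1 set) \<Rightarrow> ('a \<Rightarrow> 'a) set" where
  "graded_involutions \<Gamma> = {\<phi>. linear \<phi> \<and> bij \<phi> \<and> (\<forall>x y. \<phi> (x * y) = \<phi> y * \<phi> x) \<and>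
     (\<forall>x. \<phi> (\<phi> x) = x) \<and> (\<forall>g. \<phi> ` \<Gamma> g \<subseteq> \<Gamma> g)}"

definition isomorphic_pairs ::
    "('g \<Rightarrow> 'a::real_algebra_1 set) \<Rightarrow> ('a \<Rightarrow> 'a) \<Rightarrow>
     ('g \<Rightarrow> 'b::real_algebra_1 set) \<Rightarrow> ('b \<Rightarrow> 'b) \<Rightarrow> bool" where
  "isomorphic_pairs \<Gamma> \<phi> \<Gamma>' \<phi>' \<longleftrightarrow>
     (\<exists>\<psi>. alg_iso \<psi> \<and> \<phi>' \<circ> \<psi> = \<psi> \<circ> \<phi> \<and> (\<forall>g. \<psi> ` \<Gamma> g = \<Gamma>' g))"

definition equivalent_pairs ::
    "('g \<Rightarrow> 'a::real_algebra_1 set) \<Rightarrow> ('a \<Rightarrow> 'a) \<Rightarrow>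
     ('h \<Rightarrow> 'b::real_algebra_1 set) \<Rightarrow> ('b \<Rightarrow> 'b) \<Rightarrow> bool" where
  "equivalent_pairs \<Gamma> \<phi> \<Gamma>' \<phi>' \<longleftrightarrow>
     (\<exists>\<psi>. alg_iso \<psi> \<and> \<phi>' \<circ> \<psi> = \<psi> \<circ> \<phi> \<and> (\<forall>g\<in>support \<Gamma>. \<exists>h. \<psi> ` \<Gamma> g = \<Gamma>' h))"

definition alternating_bicharacter ::
    "'g::ab_group_add set \<Rightarrow> ('g \<Rightarrow> 'g \<Rightarrow> real) \<Rightarrow> bool" where
  "alternating_bicharacter T \<beta> \<longleftrightarrow>
     (\<forall>u\<in>T. \<forall>v\<in>T. \<beta> u v \<noteq> 0) \<and>
     (\<forall>u\<in>T. \<forall>v\<in>T. \<forall>w\<in>T. \<beta> (u + v) w = \<beta> u w * \<beta> v w) \<and>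
     (\<forall>u\<in>T. \<forall>v\<in>T. \<forall>w\<in>T. \<beta> u (v + w) = \<beta> u v * \<beta> u w) \<and>
     (\<forall>u\<in>T. \<beta> u u = 1)"

definition radical :: "'g set \<Rightarrow> ('g \<Rightarrow> 'g \<Rightarrow> real) \<Rightarrow> 'g set" where
  "radical T \<beta> = {t \<in> T. \<forall>u\<in>T. \<beta> u t = 1}"

definition type_II :: "'g set \<Rightarrow> ('g \<Rightarrow> 'g \<Rightarrow> real) \<Rightarrow> bool" where
  "type_II T \<beta> \<longleftrightarrow> card (radical T \<beta>) = 2"

text \<open>The distinguished element \<open>f\<^sub>\<beta>\<close>, meaningful for \<open>\<beta>\<close> of type II.\<close>
definition rad_elt :: "'g::ab_group_add set \<Rightarrow> ('g \<Rightarrow> 'g \<Rightarrow> real) \<Rightarrow> 'g" where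
  "rad_elt T \<beta> = (THE f. f \<noteq> 0 \<and> radical T \<beta> = {0, f})"

definition polarization :: "('g::ab_group_add \<Rightarrow> real) \<Rightarrow> 'g \<Rightarrow> 'g \<Rightarrow> real" where
  "polarization \<mu> u v = \<mu> (u + v) * inverse (\<mu> u) * inverse (\<mu> v)"

definition quadratic_form :: "'g::ab_group_add set \<Rightarrow> ('g \<Rightarrow> real) \<Rightarrow> bool" where
  "quadratic_form T \<mu> \<longleftrightarrow>
     \<mu> \<in> T \<rightarrow>\<^sub>E {1, -1} \<and> alternating_bicharacter T (polarization \<mu>)"

definition quadratic_forms ::
    "'g::ab_group_add set \<Rightarrow> ('g \<Rightarrow> 'g \<Rightarrow> real) \<Rightarrow> ('g \<Rightarrow> real) set" where
  "quadratic_forms T \<beta> =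
     {\<eta>. quadratic_form T \<eta> \<and> (\<forall>u\<in>T. \<forall>v\<in>T. polarization \<eta> u v = \<beta> u v)}"

definition Arf :: "'g set \<Rightarrow> ('g \<Rightarrow> real) \<Rightarrow> int" where
  "Arf T \<mu> =
     (if card {t\<in>T. \<mu> t = 1} > card {t\<in>T. \<mu> t = -1} then 1
      else if card {t\<in>T. \<mu> t = 1} < card {t\<in>T. \<mu> t = -1} then -1
      else 0)"

definition grading_beta :: "('g \<Rightarrow> 'a::real_algebra_1 set) \<Rightarrow> 'g \<Rightarrow> 'g \<Rightarrow> real" where
  "grading_beta \<Gamma> u v =
     (THE b. \<forall>X\<in>\<Gamma> u - {0}. \<forall>Y\<in>\<Gamma> v - {0}. X * Y = b *\<^sub>R (Y * X))"

definition grading_mu :: "('g \<Rightarrow> 'a::real_algebra_1 set) \<Rightarrow> 'g \<Rightarrow> real" where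
  "grading_mu \<Gamma> = (\<lambda>t\<in>support \<Gamma>.
     THE s. s \<in> {1, -1} \<and> (\<forall>X\<in>\<Gamma> t - {0}. \<exists>c>0. X * X = c *\<^sub>R (s *\<^sub>R 1)))"

definition corresponds ::
    "('g \<Rightarrow> 'a::real_algebra_1 set) \<Rightarrow> ('a \<Rightarrow> 'a) \<Rightarrow> ('g \<Rightarrow> real) \<Rightarrow> bool" where
  "corresponds \<Gamma> \<phi> \<eta> \<longleftrightarrow> (\<forall>t\<in>support \<Gamma>. \<forall>X\<in>\<Gamma> t. \<phi> X = \<eta> t *\<^sub>R X)"

definition form_class ::
    "'g::ab_group_add set \<Rightarrow> ('g \<Rightarrow> 'g \<Rightarrow> real) \<Rightarrow> ('g \<Rightarrow> real) \<Rightarrow> nat \<Rightarrow> ('g \<Rightarrow> real) set" where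
  "form_class T \<beta> \<mu> i = {\<eta> \<in> quadratic_forms T \<beta>.
     i = 1 \<and> \<eta> = \<mu> \<or>
     i = 2 \<and> \<eta> (rad_elt T \<beta>) = -1 \<and> \<eta> \<noteq> \<mu> \<or>
     i = 3 \<and> \<eta> (rad_elt T \<beta>) = 1 \<and> Arf T \<eta> = 1 \<or>
     i = 4 \<and> \<eta> (rad_elt T \<beta>) = 1 \<and> Arf T \<eta> = -1}"

end

theory Submission
  imports Defs
begin

text \<open>
  Normalize \<open>X t \<in> \<Gamma> t\<close> so that \<open>X t * X t = \<mu> t\<close>; the structure constants of this basis form a
  cocycle on \<open>T\<close>.  The centre of \<open>M\<^sub>n(\<complex>)\<close> is \<open>\<complex>\<close> and is a graded subspace, so exactly one
  \<open>f \<noteq> 0\<close> in \<open>T\<close> has \<open>X f\<close> central, and \<open>X f\<close> is purely imaginary.  Two gradings with the same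
  \<open>T\<close> and \<open>\<mu>\<close> have structure constants whose quotient is a symmetric cocycle with trivial
  diagonal, hence a coboundary; rescaling the basis gives an isomorphism.

  For the equivalences, two forms \<open>\<eta>\<close> and \<open>\<eta>'\<close> that agree at \<open>f\<close> satisfy \<open>\<eta>' = \<eta> \<cdot> \<beta>(w,_)\<close> for some
  \<open>w\<close>, and replacing \<open>w\<close> by \<open>w + f\<close> one may take \<open>\<mu> w = -1\<close>.  Conjugation by \<open>1 + X w\<close> then permutes
  the components by a transvection, which maps \<open>\<eta>\<close> to \<open>\<eta>'\<close> provided that \<open>\<eta> w = 1\<close>.  If \<open>\<eta> f = 1\<close> this
  condition says that the Arf invariants agree; if \<open>\<eta> f = -1\<close> and both forms differ from \<open>\<mu>\<close>, two
  transvections suffice.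
\<close>

section \<open>Characters and quadratic forms on elementary abelian 2-groups\<close>

text \<open>Homomorphisms from a group of exponent 2 to the nonzero reals take values in {1, -1}, so
  fixing the range loses nothing. Values off \<open>T\<close> are left free, so that each
  \<open>\<beta> w\<close> counts as a character.\<close>

definition character :: "'g::ab_group_add set \<Rightarrow> ('g \<Rightarrow> real) \<Rightarrow> bool" where
  "character T \<kappa> \<longleftrightarrow> (\<forall>t\<in>T. \<kappa> t \<in> {1, -1}) \<and> (\<forall>s\<in>T. \<forall>t\<in>T. \<kappa> (s + t) = \<kappa> s * \<kappa> t)"

lemma UNIV_bit: "(UNIV :: bit set) = {0, 1}"
  using bit.exhaust by auto

locale elementary_2_group =
  fixes T :: "'g::ab_group_add set" and k :: nat
  assumes subgroup: "add_subgroup T" and iso: "iso_Z2_power k T"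
begin

lemma zero_mem [simp]: "0 \<in> T"
  and add_mem [simp]: "s \<in> T \<Longrightarrow> t \<in> T \<Longrightarrow> s + t \<in> T"
  using subgroup by (auto simp: add_subgroup_def)

lemma coordinates:
  obtains f where "bij_betw f T ({..<k} \<rightarrow>\<^sub>E (UNIV :: bit set))"
    "\<And>s t i. s \<in> T \<Longrightarrow> t \<in> T \<Longrightarrow> i < k \<Longrightarrow> f (s + t) i = f s i + f t i"
    "\<And>i. i < k \<Longrightarrow> f 0 i = 0"
proof -
  obtain f where f: "bij_betw f T ({..<k} \<rightarrow>\<^sub>E (UNIV :: bit set))"
    and add: "\<And>s t i. s \<in> T \<Longrightarrow> t \<in> T \<Longrightarrow> i < k \<Longrightarrow> f (s + t) i = f s i + f t i"
    using iso unfolding iso_Z2_power_def by blast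
  have "f 0 i = 0" if "i < k" for i
    using add[of 0 0 i] that by simp
  with f add show ?thesis by (rule that)
qed

lemma finite_T [simp]: "finite T"
proof -
  obtain f where "bij_betw f T ({..<k} \<rightarrow>\<^sub>E (UNIV :: bit set))" by (rule coordinates)
  moreover have "finite ({..<k} \<rightarrow>\<^sub>E (UNIV :: bit set))" by (simp add: finite_PiE UNIV_bit)
  ultimately show ?thesis by (simp add: bij_betw_finite)
qed

lemma card_T: "card T = 2 ^ k"
proof -
  obtain f where "bij_betw f T ({..<k} \<rightarrow>\<^sub>E (UNIV :: bit set))" by (rule coordinates)
  then have "card T = card ({..<k} \<rightarrow>\<^sub>E (UNIV :: bit set))" by (rule bij_betw_same_card)
  also have "\<dots> = card (UNIV :: bit set) ^ k" by (simp add: card_PiE)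
  finally show ?thesis by (simp add: UNIV_bit numeral_2_eq_2)
qed

text \<open>Distinct points of \<open>T\<close> differ in some coordinate; comparing
  \<open>t\<close> with 0 gives a coordinate equal to 1 at \<open>t\<close>. Exponent 2 and the
  separation of points by characters both rest on this.\<close>

lemma separating_coordinate:
  assumes "t \<in> T" "t \<noteq> 0"
  obtains c :: "'g \<Rightarrow> bit" where "\<And>s t. s \<in> T \<Longrightarrow> t \<in> T \<Longrightarrow> c (s + t) = c s + c t" "c t = 1"
proof -
  obtain f where f: "bij_betw f T ({..<k} \<rightarrow>\<^sub>E (UNIV :: bit set))"
    and add: "\<And>s t i. s \<in> T \<Longrightarrow> t \<in> T \<Longrightarrow> i < k \<Longrightarrow> f (s + t) i = f s i + f t i"
    and zero: "\<And>i. i < k \<Longrightarrow> f 0 i = 0" by (rule coordinates) blast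
  have "f t \<noteq> f 0"
    using f assms by (auto simp: bij_betw_def inj_on_def)
  moreover have "f t \<in> {..<k} \<rightarrow>\<^sub>E UNIV" "f 0 \<in> {..<k} \<rightarrow>\<^sub>E UNIV"
    using f assms zero_mem unfolding bij_betw_def by blast+
  ultimately obtain i where "i < k" "f t i \<noteq> f 0 i"
    by (metis PiE_ext lessThan_iff)
  then show ?thesis using that[of "\<lambda>t. f t i"] add zero by auto
qed

text \<open>Otherwise some coordinate would be 1 at \<open>t + t\<close>, but additive maps into
  \<open>bit\<close> vanish on doubles.\<close>

lemma add_self [simp]:
  assumes "t \<in> T" shows "t + t = 0"
proof (rule ccontr)
  assume "t + t \<noteq> 0"
  then obtain c :: "'g \<Rightarrow> bit"
    where "\<And>s t. s \<in> T \<Longrightarrow> t \<in> T \<Longrightarrow> c (s + t) = c s + c t" "c (t + t) = 1"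
    by (rule separating_coordinate[rotated]) (use assms in auto)
  then show False using assms by (cases "c t") simp_all
qed

lemma add_self_left [simp]: "s \<in> T \<Longrightarrow> s + (s + t) = t"
  by (simp flip: add.assoc)

lemma bij_betw_translation: "a \<in> T \<Longrightarrow> bij_betw ((+) a) T T"
  by (rule bij_betw_byWitness[where f' = "(+) a"]) auto

lemma sum_translation: "a \<in> T \<Longrightarrow> (\<Sum>t\<in>T. g (a + t)) = (\<Sum>t\<in>T. g t)"
  by (rule sum.reindex_bij_betw[OF bij_betw_translation])

lemma character_separates:
  assumes "t \<in> T" "t \<noteq> 0"
  obtains \<kappa> where "character T \<kappa>" "\<kappa> t = -1"
proof -
  obtain c :: "'g \<Rightarrow> bit" where c: "\<And>s t. s \<in> T \<Longrightarrow> t \<in> T \<Longrightarrow> c (s + t) = c s + c t" "c t = 1"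
    using assms by (rule separating_coordinate) blast
  have "character T (\<lambda>t. if c t = 1 then -1 else 1)"
    unfolding character_def using c(1) by (auto)
  from that[OF this] c(2) show ?thesis by simp
qed

lemma character_zero: "character T \<kappa> \<Longrightarrow> \<kappa> 0 = 1"
  unfolding character_def by (metis add_0 mult_cancel_right1 one_neq_zero zero_mem insertE mult_1 neg_equal_0_iff_equal singletonD)

lemma character_mult:
  "character T \<kappa> \<Longrightarrow> character T \<kappa>' \<Longrightarrow> character T (\<lambda>t. \<kappa> t * \<kappa>' t)"
  unfolding character_def by (fastforce simp: mult_ac)

text \<open>Translation by \<open>a\<close> permutes \<open>T\<close> and multiplies the sum by
  \<open>\<kappa> a\<close>, which is not 1.\<close>

lemma sum_character:
  assumes "character T \<kappa>" "a \<in> T" "\<kappa> a \<noteq> 1"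
  shows "sum \<kappa> T = 0"
proof -
  have "sum \<kappa> T = (\<Sum>t\<in>T. \<kappa> (a + t))" using assms by (simp add: sum_translation)
  also have "\<dots> = \<kappa> a * sum \<kappa> T"
    using assms unfolding character_def by (auto simp: sum_distrib_left intro!: sum.cong)
  finally show ?thesis using assms(3) by simp
qed

lemma sum_character_eq:
  assumes "character T \<kappa>"
  shows "sum \<kappa> T = (if \<forall>t\<in>T. \<kappa> t = 1 then card T else 0)"
  using sum_character[OF assms] by auto

text \<open>Double counting in the table of values \<open>\<kappa> t\<close>. Only the trivial
  character has a nonzero row sum, namely \<open>card T\<close>; only \<open>t = 0\<close> has a
  nonzero column sum, namely the number of characters. Hence the two numbers agree.\<close>

lemma card_characters: "card {\<kappa> \<in> T \<rightarrow>\<^sub>E {1, -1}. character T \<kappa>} = card T"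
proof -
  let ?C = "{\<kappa> \<in> T \<rightarrow>\<^sub>E {1, -1}. character T \<kappa>}"
  let ?e = "\<lambda>t\<in>T. 1 :: real"
  have fin: "finite ?C"
    by (rule finite_subset[of _ "T \<rightarrow>\<^sub>E {1, -1}"]) (auto intro: finite_PiE)
  have eC: "?e \<in> ?C"
    by (auto simp: character_def)
  have row: "sum \<kappa> T = (if \<kappa> = ?e then real (card T) else 0)" if "\<kappa> \<in> ?C" for \<kappa>
  proof -
    have "(\<forall>t\<in>T. \<kappa> t = 1) \<longleftrightarrow> \<kappa> = ?e"
      using that by (auto intro!: PiE_ext[of _ T "\<lambda>_. {1, -1}"])
    then show ?thesis using sum_character_eq that by auto
  qed
  have col: "(\<Sum>\<kappa>\<in>?C. \<kappa> t) = (if t = 0 then real (card ?C) else 0)" if t: "t \<in> T" for t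
  proof (cases "t = 0")
    case True
    then show ?thesis by (simp add: character_zero)
  next
    case False
    then obtain \<omega> where \<omega>: "character T \<omega>" "\<omega> t = -1"
      using t character_separates by blast
    \<comment> \<open>Multiplication by a character with value -1 at \<open>t\<close> is an
      involution on the set of characters that flips the value at \<open>t\<close>, so the column
      sum equals its own negative.\<close>
    define h where "h \<kappa> = (\<lambda>s\<in>T. \<omega> s * \<kappa> s)" for \<kappa>
    have "h \<kappa> \<in> ?C" if "\<kappa> \<in> ?C" for \<kappa>
    proof -
      have "character T (\<lambda>s. \<omega> s * \<kappa> s)" using that \<omega>(1) character_mult by blast
      then show ?thesis by (auto simp: h_def character_def)
    qed
    moreover have "h (h \<kappa>) = \<kappa>" if "\<kappa> \<in> ?C" for \<kappa>
      using that \<omega>(1) by (fastforce simp: h_def character_def fun_eq_iff PiE_def extensional_def)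
    ultimately have "bij_betw h ?C ?C"
      by (intro bij_betw_byWitness[where f' = h]) blast+
    then have "(\<Sum>\<kappa>\<in>?C. \<kappa> t) = (\<Sum>\<kappa>\<in>?C. h \<kappa> t)" by (rule sum.reindex_bij_betw[symmetric])
    also have "\<dots> = - (\<Sum>\<kappa>\<in>?C. \<kappa> t)" using t \<omega>(2) by (simp add: h_def sum_negf)
    finally show ?thesis using False by simp
  qed
  have "real (card ?C) = (\<Sum>t\<in>T. \<Sum>\<kappa>\<in>?C. \<kappa> t)"
    using col by (simp add: sum.delta)
  also have "\<dots> = (\<Sum>\<kappa>\<in>?C. sum \<kappa> T)" by (rule sum.swap)
  also have "\<dots> = real (card T)"
    using row fin eC by (simp add: sum.delta)
  finally show ?thesis by simp
qed

end

section \<open>Alternating bicharacters and the quadratic forms that polarize to them\<close>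

locale alternating_form = elementary_2_group T k
  for T :: "'g::ab_group_add set" and k +
  fixes \<beta> :: "'g \<Rightarrow> 'g \<Rightarrow> real"
  assumes alternating: "alternating_bicharacter T \<beta>"
begin

lemma \<beta>_add_left: "u \<in> T \<Longrightarrow> v \<in> T \<Longrightarrow> w \<in> T \<Longrightarrow> \<beta> (u + v) w = \<beta> u w * \<beta> v w"
  and \<beta>_add_right: "u \<in> T \<Longrightarrow> v \<in> T \<Longrightarrow> w \<in> T \<Longrightarrow> \<beta> u (v + w) = \<beta> u v * \<beta> u w"
  and \<beta>_self [simp]: "u \<in> T \<Longrightarrow> \<beta> u u = 1"
  and \<beta>_nonzero: "u \<in> T \<Longrightarrow> v \<in> T \<Longrightarrow> \<beta> u v \<noteq> 0"
  using alternating by (auto simp: alternating_bicharacter_def)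

lemma \<beta>_zero [simp]: "u \<in> T \<Longrightarrow> \<beta> u 0 = 1" "u \<in> T \<Longrightarrow> \<beta> 0 u = 1"
  using \<beta>_add_right[of u 0 0] \<beta>_add_left[of 0 0 u] \<beta>_nonzero[of u 0] \<beta>_nonzero[of 0 u] by auto

lemma \<beta>_sign: "u \<in> T \<Longrightarrow> v \<in> T \<Longrightarrow> \<beta> u v \<in> {1, -1}"
  using \<beta>_add_right[of u v v] by (auto simp: square_eq_1_iff)

lemma \<beta>_square [simp]: "u \<in> T \<Longrightarrow> v \<in> T \<Longrightarrow> \<beta> u v * \<beta> u v = 1"
  using \<beta>_sign by fastforce

text \<open>Expanding \<open>\<beta> (u + v) (u + v) = 1\<close> leaves
  \<open>\<beta> u v * \<beta> v u = 1\<close>, and signs that are inverse to each other are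
  equal.\<close>

lemma \<beta>_sym: 
  assumes "u \<in> T" "v \<in> T" shows "\<beta> u v = \<beta> v u"
proof -
  have "\<beta> (u + v) (u + v) = \<beta> u v * \<beta> v u"
    using assms by (simp only: \<beta>_add_left \<beta>_add_right add_mem) simp
  then have "\<beta> u v * \<beta> v u = 1" using assms by simp
  then show ?thesis using \<beta>_sign[OF assms] by auto
qed

lemma character_\<beta>: "w \<in> T \<Longrightarrow> character T (\<beta> w)"
  using \<beta>_sign by (auto simp: character_def \<beta>_add_right)

text \<open>The polarization identity is cleared of inverses, which is possible because the values
  are signs; later computations use this product form.\<close>

lemma quadratic_formsD:
  assumes "\<eta> \<in> quadratic_forms T \<beta>"
  shows "\<eta> \<in> T \<rightarrow>\<^sub>E {1, -1}"
    and "\<And>t. t \<in> T \<Longrightarrow> \<eta> t \<in> {1, -1}"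
    and "\<And>u v. u \<in> T \<Longrightarrow> v \<in> T \<Longrightarrow> \<eta> (u + v) = \<eta> u * \<eta> v * \<beta> u v"
    and "\<eta> 0 = 1"
proof -
  show ext: "\<eta> \<in> T \<rightarrow>\<^sub>E {1, -1}"
    using assms by (simp add: quadratic_forms_def quadratic_form_def)
  then show sgn: "\<eta> t \<in> {1, -1}" if "t \<in> T" for t
    using that by blast
  show add: "\<eta> (u + v) = \<eta> u * \<eta> v * \<beta> u v" if "u \<in> T" "v \<in> T" for u v
  proof -
    have "\<beta> u v = \<eta> (u + v) * inverse (\<eta> u) * inverse (\<eta> v)"
      using assms that by (simp add: quadratic_forms_def polarization_def)
    then show ?thesis using sgn[OF that(1)] sgn[OF that(2)] by auto
  qed
  show "\<eta> 0 = 1" using add[of 0 0] sgn[of 0] by auto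
qed

lemma quadratic_formsI:
  assumes "\<eta> \<in> T \<rightarrow>\<^sub>E {1, -1}" "\<And>u v. u \<in> T \<Longrightarrow> v \<in> T \<Longrightarrow> \<eta> (u + v) = \<eta> u * \<eta> v * \<beta> u v"
  shows "\<eta> \<in> quadratic_forms T \<beta>"
proof -
  have pol: "polarization \<eta> u v = \<beta> u v" if "u \<in> T" "v \<in> T" for u v
  proof -
    have "\<eta> u \<in> {1, -1}" "\<eta> v \<in> {1, -1}" using assms(1) that by blast+
    then show ?thesis using that by (auto simp: polarization_def assms(2))
  qed
  then have "alternating_bicharacter T (polarization \<eta>)"
    using alternating by (simp add: alternating_bicharacter_def)
  then show ?thesis using assms(1) pol by (simp add: quadratic_forms_def quadratic_form_def)
qed

text \<open>Signs are their own inverses, so the product is also the quotient of the two forms, in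
  which the common polarization \<open>\<beta>\<close> cancels.\<close>

lemma quadratic_forms_quotient:
  assumes "\<eta> \<in> quadratic_forms T \<beta>" "\<eta>' \<in> quadratic_forms T \<beta>"
  shows "character T (\<lambda>t. \<eta> t * \<eta>' t)"
  unfolding character_def
proof (intro conjI ballI)
  note \<eta> = quadratic_formsD[OF assms(1)] and \<eta>' = quadratic_formsD[OF assms(2)]
  fix s assume s: "s \<in> T"
  show "\<eta> s * \<eta>' s \<in> {1, -1}" using \<eta>(2)[OF s] \<eta>'(2)[OF s] by auto
  fix t assume t: "t \<in> T"
  show "\<eta> (s + t) * \<eta>' (s + t) = (\<eta> s * \<eta>' s) * (\<eta> t * \<eta>' t)"
    using \<beta>_sign[OF s t] by (auto simp: \<eta>(3) \<eta>'(3) s t)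
qed

lemma quadratic_forms_twist:
  assumes \<eta>: "\<eta> \<in> quadratic_forms T \<beta>" and \<kappa>: "character T \<kappa>"
  shows "(\<lambda>t\<in>T. \<eta> t * \<kappa> t) \<in> quadratic_forms T \<beta>"
proof (rule quadratic_formsI)
  show "(\<lambda>t\<in>T. \<eta> t * \<kappa> t) \<in> T \<rightarrow>\<^sub>E {1, -1}"
    using quadratic_formsD(2)[OF \<eta>] \<kappa> by (fastforce simp: character_def)
  show "(\<lambda>t\<in>T. \<eta> t * \<kappa> t) (u + v) = (\<lambda>t\<in>T. \<eta> t * \<kappa> t) u * (\<lambda>t\<in>T. \<eta> t * \<kappa> t) v * \<beta> u v"
    if "u \<in> T" "v \<in> T" for u v
    using that \<kappa> by (simp add: quadratic_formsD(3)[OF \<eta>] character_def)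
qed

text \<open>The forms with polarization \<open>\<beta>\<close> are a torsor under the characters:
  multiplication by \<open>\<mu>\<close>, which is its own inverse, matches forms with characters,
  and there are \<open>card T\<close> of the latter.\<close>

lemma card_quadratic_forms:
  assumes \<mu>: "\<mu> \<in> quadratic_forms T \<beta>"
  shows "card (quadratic_forms T \<beta>) = 2 ^ k"
proof -
  let ?C = "{\<kappa> \<in> T \<rightarrow>\<^sub>E {1, -1}. character T \<kappa>}"
  let ?h = "\<lambda>\<kappa>. \<lambda>t\<in>T. \<mu> t * \<kappa> t"
  note \<mu>2 = quadratic_formsD(2)[OF \<mu>]
  have inv: "?h (?h \<kappa>) = \<kappa>" if "\<kappa> \<in> T \<rightarrow>\<^sub>E {1, -1}" for \<kappa>
    using that \<mu>2 by (fastforce simp: fun_eq_iff PiE_def extensional_def)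
  have "bij_betw ?h ?C (quadratic_forms T \<beta>)"
  proof (rule bij_betw_byWitness[where f' = ?h])
    show "\<forall>\<kappa>\<in>?C. ?h (?h \<kappa>) = \<kappa>" using inv by blast
    show "\<forall>\<kappa>\<in>quadratic_forms T \<beta>. ?h (?h \<kappa>) = \<kappa>" using inv quadratic_formsD(1) by blast
    show "?h ` ?C \<subseteq> quadratic_forms T \<beta>" using quadratic_forms_twist[OF \<mu>] by blast
    show "?h ` quadratic_forms T \<beta> \<subseteq> ?C"
    proof (rule image_subsetI)
      fix \<eta> assume \<eta>: "\<eta> \<in> quadratic_forms T \<beta>"
      have ch: "character T (\<lambda>t. \<mu> t * \<eta> t)" by (rule quadratic_forms_quotient[OF \<mu> \<eta>])
      then show "?h \<eta> \<in> ?C" by (auto simp: character_def)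
    qed
  qed
  then have "card (quadratic_forms T \<beta>) = card ?C" by (simp add: bij_betw_same_card)
  then show ?thesis by (simp add: card_characters card_T)
qed

end

text \<open>The sum of the values is the difference of the two counts. This makes Arf invariants
  accessible to character sums.\<close>

lemma Arf_eq_sgn_sum:
  assumes "finite T" "\<And>t. t \<in> T \<Longrightarrow> \<eta> t \<in> {1, -1}"
  shows "real_of_int (Arf T \<eta>) = sgn (sum \<eta> T)"
proof -
  let ?P = "{t\<in>T. \<eta> t = 1}" and ?N = "{t\<in>T. \<eta> t = -1}"
  have "sum \<eta> T = sum \<eta> ?P + sum \<eta> ?N"
    by (subst sum.union_disjoint[symmetric])
       (use assms in \<open>auto intro!: arg_cong2[where f = sum]\<close>)
  also have "\<dots> = real (card ?P) - real (card ?N)" by simp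
  finally have "sum \<eta> T = real (card ?P) - real (card ?N)" .
  then show ?thesis by (auto simp: Arf_def)
qed

section \<open>Type II forms: sums over the radical and the Arf invariant\<close>

locale type_II_form = alternating_form T k \<beta>
  for T :: "'g::ab_group_add set" and k \<beta> +
  fixes f :: 'g
  assumes f_nonzero: "f \<noteq> 0" and radical_eq: "radical T \<beta> = {0, f}"
begin

lemma f_mem [simp]: "f \<in> T" and \<beta>_f: "u \<in> T \<Longrightarrow> \<beta> u f = 1"
  using radical_eq by (auto simp: radical_def)

lemma rad_elt_eq: "rad_elt T \<beta> = f"
  unfolding rad_elt_def using f_nonzero radical_eq by (auto simp: doubleton_eq_iff)

text \<open>Orthogonality: by symmetry this is the sum of the character \<open>\<beta> t\<close>,
  which is trivial exactly when \<open>t\<close> is in the radical.\<close>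

lemma sum_\<beta>: 
  assumes "t \<in> T" shows "(\<Sum>w\<in>T. \<beta> w t) = (if t \<in> {0, f} then card T else 0)"
proof -
  have "(\<Sum>w\<in>T. \<beta> w t) = sum (\<beta> t) T" by (rule sum.cong) (simp_all add: assms \<beta>_sym)
  also have "\<dots> = (if \<forall>u\<in>T. \<beta> t u = 1 then card T else 0)"
    by (rule sum_character_eq[OF character_\<beta>[OF assms]])
  also have "(\<forall>u\<in>T. \<beta> t u = 1) \<longleftrightarrow> t \<in> radical T \<beta>"
    using assms by (auto simp: radical_def \<beta>_sym[of t])
  finally show ?thesis by (simp add: radical_eq)
qed

text \<open>By orthogonality the double sum collapses to the radical. This serves both the Fourier
  argument for characters and the Gauss sum of a quadratic form.\<close>

lemma sum_over_radical:
  fixes g :: "'g \<Rightarrow> real"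
  shows "(\<Sum>t\<in>T. g t * (\<Sum>w\<in>T. \<beta> w t)) = card T * (g 0 + g f)"
proof -
  have "(\<Sum>t\<in>T. g t * (\<Sum>w\<in>T. \<beta> w t)) = (\<Sum>t\<in>T. if t \<in> {0, f} then g t * card T else 0)"
    by (rule sum.cong) (auto simp: sum_\<beta>)
  also have "\<dots> = (\<Sum>t\<in>{0, f}. g t * card T)"
    by (subst sum.inter_restrict[symmetric]) (auto intro!: arg_cong2[where f = sum])
  also have "\<dots> = card T * (g 0 + g f)" using f_nonzero by (simp add: algebra_simps)
  finally show ?thesis .
qed

lemma card_T_pos: "card T > 0"
  by (simp add: card_T)

text \<open>Summing the Fourier coefficients of \<open>\<kappa>\<close> at the characters \<open>\<beta> w\<close> over all \<open>w\<close> gives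
  \<open>|T| (\<kappa> 0 + \<kappa> f) = 2 |T|\<close>, so one of them does not vanish.\<close>
lemma character_eq_\<beta>:
  assumes \<kappa>: "character T \<kappa>" and "\<kappa> f = 1"
  obtains w where "w \<in> T" "\<And>t. t \<in> T \<Longrightarrow> \<kappa> t = \<beta> w t"
proof -
  have "(\<Sum>w\<in>T. \<Sum>t\<in>T. \<beta> w t * \<kappa> t) = (\<Sum>t\<in>T. \<kappa> t * (\<Sum>w\<in>T. \<beta> w t))"
    by (subst sum.swap) (simp add: sum_distrib_left mult.commute)
  also have "\<dots> = 2 * card T"
    using assms by (simp add: sum_over_radical character_zero)
  finally obtain w where w: "w \<in> T" "(\<Sum>t\<in>T. \<beta> w t * \<kappa> t) \<noteq> 0"
    using card_T_pos sum.neutral by (metis (no_types, lifting) mult_eq_0_iff of_nat_0_eq_iff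
        order_less_irrefl zero_neq_numeral)
  \<comment> \<open>A character with nonzero sum is trivial, and for sign-valued functions a trivial
    product means equality.\<close>
  have "character T (\<lambda>t. \<beta> w t * \<kappa> t)"
    by (rule character_mult[OF character_\<beta>[OF w(1)] \<kappa>])
  with w(2) have "\<forall>t\<in>T. \<beta> w t * \<kappa> t = 1"
    using sum_character by blast
  then have "\<kappa> t = \<beta> w t" if "t \<in> T" for t
    using \<kappa> that unfolding character_def by fastforce
  with w(1) show ?thesis by (rule that)
qed

lemma \<beta>_add_f_left: "u \<in> T \<Longrightarrow> v \<in> T \<Longrightarrow> \<beta> (u + f) v = \<beta> u v"
  using \<beta>_f[of v] \<beta>_sym[of f v] by (simp add: \<beta>_add_left)

lemma quadratic_forms_differ:
  assumes \<mu>: "\<mu> \<in> quadratic_forms T \<beta>" "\<mu> f = -1"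
    and \<eta>: "\<eta> \<in> quadratic_forms T \<beta>" and \<eta>': "\<eta>' \<in> quadratic_forms T \<beta>" and "\<eta> f = \<eta>' f"
  obtains w where "w \<in> T" "\<mu> w = -1" "\<And>t. t \<in> T \<Longrightarrow> \<eta>' t = \<eta> t * \<beta> w t"
proof -
  have sq: "\<eta> t * (\<eta> t * \<eta>' t) = \<eta>' t" if "t \<in> T" for t
    using quadratic_formsD(2)[OF \<eta> that] by auto
  have "\<eta> f * \<eta>' f = 1" using assms(5) quadratic_formsD(2)[OF \<eta> f_mem] by auto
  then obtain w where w: "w \<in> T" "\<And>t. t \<in> T \<Longrightarrow> \<eta> t * \<eta>' t = \<beta> w t"
    using character_eq_\<beta>[OF quadratic_forms_quotient[OF \<eta> \<eta>']] by blast
  have eq: "\<eta>' t = \<eta> t * \<beta> w t" if "t \<in> T" for t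
    using w(2)[OF that] sq[OF that] by simp
  \<comment> \<open>Since \<open>f\<close> lies in the radical and \<open>\<mu> f = -1\<close>,
    passing from \<open>w\<close> to \<open>w + f\<close> keeps \<open>\<beta> w\<close> and flips
    the sign of \<open>\<mu> w\<close>.\<close>
  show ?thesis
  proof (cases "\<mu> w = -1")
    case True
    then show ?thesis using that w(1) eq by blast
  next
    case False
    then have "\<mu> (w + f) = -1"
      using quadratic_formsD(2)[OF \<mu>(1) w(1)] w(1)
      by (auto simp: quadratic_formsD(3)[OF \<mu>(1)] \<mu>(2) \<beta>_f)
    then show ?thesis
      by (rule that[rotated]) (use w(1) eq in \<open>auto simp: \<beta>_add_f_left\<close>)
  qed
qed

text \<open>A Gauss sum: after the substitution \<open>t = s + u\<close> each product
  \<open>\<eta> s * \<eta> (s + u)\<close> becomes \<open>\<eta> u * \<beta> s u\<close>, and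
  summing over \<open>s\<close> leaves only \<open>u = 0\<close> and \<open>u = f\<close>. So the
  sum of the values is nonzero exactly when \<open>\<eta> f = 1\<close>.\<close>

lemma square_sum_quadratic_form:
  fixes \<eta> :: "'g \<Rightarrow> real"
  assumes \<eta>: "\<eta> \<in> quadratic_forms T \<beta>"
  shows "(sum \<eta> T)\<^sup>2 = card T * (1 + \<eta> f)"
proof -
  note \<eta>D = quadratic_formsD[OF \<eta>]
  have "(sum \<eta> T)\<^sup>2 = (\<Sum>s\<in>T. \<Sum>t\<in>T. \<eta> s * \<eta> t)"
    by (simp add: power2_eq_square sum_product)
  also have "\<dots> = (\<Sum>s\<in>T. \<Sum>u\<in>T. \<eta> s * \<eta> (s + u))"
    by (rule sum.cong[OF refl], rule sum_translation[symmetric])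
  also have "\<dots> = (\<Sum>s\<in>T. \<Sum>u\<in>T. \<eta> u * \<beta> s u)"
  proof (intro sum.cong refl)
    fix s u assume "s \<in> T" "u \<in> T"
    then show "\<eta> s * \<eta> (s + u) = \<eta> u * \<beta> s u"
      using \<eta>D(2)[of s] by (auto simp: \<eta>D(3))
  qed
  also have "\<dots> = (\<Sum>u\<in>T. \<eta> u * (\<Sum>s\<in>T. \<beta> s u))"
    by (subst sum.swap) (simp add: sum_distrib_left)
  finally show ?thesis by (simp add: sum_over_radical \<eta>D(4))
qed

lemma Arf_sign:
  assumes \<eta>: "\<eta> \<in> quadratic_forms T \<beta>" and "\<eta> f = 1"
  shows "Arf T \<eta> \<in> {1, -1}"
proof -
  have "(sum \<eta> T)\<^sup>2 > 0"
    using square_sum_quadratic_form[OF \<eta>] assms(2) card_T_pos by simp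
  then have "sum \<eta> T \<noteq> 0" by auto
  then have "real_of_int (Arf T \<eta>) \<noteq> 0"
    using Arf_eq_sgn_sum[of T \<eta>] quadratic_formsD(2)[OF \<eta>] by (simp add: sgn_zero_iff)
  then show ?thesis by (auto simp: Arf_def split: if_splits)
qed

text \<open>Completing the square: \<open>\<eta> t * \<beta> w t = \<eta> w * \<eta> (w + t)\<close>, so twisting \<open>\<eta>\<close> by \<open>\<beta> w\<close>
  multiplies its sum by \<open>\<eta> w\<close>.\<close>
lemma eq_one_of_Arf_eq:
  assumes \<eta>: "\<eta> \<in> quadratic_forms T \<beta>" and \<eta>': "\<eta>' \<in> quadratic_forms T \<beta>"
    and w: "w \<in> T" "\<And>t. t \<in> T \<Longrightarrow> \<eta>' t = \<eta> t * \<beta> w t"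
    and "\<eta> f = 1" "Arf T \<eta>' = Arf T \<eta>"
  shows "\<eta> w = 1"
proof (rule ccontr)
  note \<eta>D = quadratic_formsD[OF \<eta>]
  assume "\<eta> w \<noteq> 1"
  then have neg: "\<eta> w = -1" using \<eta>D(2)[OF w(1)] by auto
  have "sum \<eta>' T = (\<Sum>t\<in>T. - \<eta> (w + t))"
    by (rule sum.cong) (use w neg in \<open>auto simp: \<eta>D(3)\<close>)
  also have "\<dots> = - sum \<eta> T" using w(1) by (simp add: sum_negf sum_translation)
  finally have "real_of_int (Arf T \<eta>') = - real_of_int (Arf T \<eta>)"
    using Arf_eq_sgn_sum[of T] quadratic_formsD(2)[OF \<eta>] quadratic_formsD(2)[OF \<eta>']
    by (simp add: sgn_minus)
  with assms(6) Arf_sign[OF \<eta> assms(5)] show False by auto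
qed

end

section \<open>Symmetric cocycles with trivial diagonal are coboundaries\<close>

context elementary_2_group
begin

text \<open>A symmetric cocycle with trivial diagonal describes an abelian extension of exponent 2, which
  splits; concretely, a solution on a subgroup \<open>H\<close> extends to \<open>H \<union> (a + H)\<close>.\<close>
lemma symmetric_cocycle_trivial:
  fixes \<tau> :: "'g \<Rightarrow> 'g \<Rightarrow> real"
  assumes nz: "\<And>s t. s \<in> T \<Longrightarrow> t \<in> T \<Longrightarrow> \<tau> s t \<noteq> 0"
    and sym: "\<And>s t. s \<in> T \<Longrightarrow> t \<in> T \<Longrightarrow> \<tau> s t = \<tau> t s"
    and cocycle: "\<And>s t u. s \<in> T \<Longrightarrow> t \<in> T \<Longrightarrow> u \<in> T \<Longrightarrow>
      \<tau> s t * \<tau> (s + t) u = \<tau> t u * \<tau> s (t + u)"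
    and diag: "\<And>t. t \<in> T \<Longrightarrow> \<tau> t t = 1"
  shows "\<exists>\<delta>. (\<forall>t\<in>T. \<delta> t \<noteq> 0) \<and> (\<forall>s\<in>T. \<forall>t\<in>T. \<delta> (s + t) = \<tau> s t * \<delta> s * \<delta> t)"
proof -
  \<comment> \<open>\<open>P H\<close> says that \<open>H\<close> is a subgroup (inverses come for
    free in exponent 2) on which \<open>\<tau>\<close> is a coboundary. A set of largest size with
    this property is chosen, the size being bounded by \<open>card T\<close>, and shown to be
    \<open>T\<close>.\<close>
  define P where "P H \<longleftrightarrow> H \<subseteq> T \<and> 0 \<in> H \<and> (\<forall>s\<in>H. \<forall>t\<in>H. s + t \<in> H) \<and>
    (\<exists>\<delta>. (\<forall>t\<in>H. \<delta> t \<noteq> 0) \<and> (\<forall>s\<in>H. \<forall>t\<in>H. \<delta> (s + t) = \<tau> s t * \<delta> s * \<delta> t))" for H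
  have \<tau>0: "\<tau> g 0 = 1" if "g \<in> T" for g
    using cocycle[of g 0 0] diag[of 0] nz[of g 0] that by simp
  have "P {0}"
    unfolding P_def by (auto simp: diag intro: exI[of _ "\<lambda>_. 1"])
  moreover have "\<forall>H. P H \<longrightarrow> card H < Suc (card T)"
    by (auto simp: P_def less_Suc_eq_le intro: card_mono)
  ultimately obtain H where H: "P H" and max: "\<And>H'. P H' \<Longrightarrow> card H' \<le> card H"
    using ex_has_greatest_nat[of P "{0}" card "Suc (card T)"] by metis
  from H obtain \<delta> where HT: "H \<subseteq> T" and H0: "0 \<in> H" and Hadd: "\<And>s t. s \<in> H \<Longrightarrow> t \<in> H \<Longrightarrow> s + t \<in> H"
    and \<delta>nz: "\<And>t. t \<in> H \<Longrightarrow> \<delta> t \<noteq> 0"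
    and \<delta>add: "\<And>s t. s \<in> H \<Longrightarrow> t \<in> H \<Longrightarrow> \<delta> (s + t) = \<tau> s t * \<delta> s * \<delta> t"
    unfolding P_def by blast
  have "H = T"
  proof (rule ccontr)
    assume "H \<noteq> T"
    then obtain a where a: "a \<in> T" "a \<notin> H" using HT by blast
    have mem [simp]: "h \<in> T" if "h \<in> H" for h using HT that by blast
    have coset: "a + h \<notin> H" if "h \<in> H" for h
    proof
      assume "a + h \<in> H"
      then have "h + (a + h) \<in> H" using Hadd that by blast
      moreover have "h + (a + h) = a" using that by (simp add: add.left_commute)
      ultimately show False using a by simp
    qed
    \<comment> \<open>The value at \<open>a\<close> is normalized to 1, which forces
      \<open>\<epsilon> (a + h) = \<tau> a h * \<delta> h\<close>; for \<open>x = a + h\<close> the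
      element \<open>h\<close> is recovered as \<open>a + x\<close>.\<close>
    define \<epsilon> where "\<epsilon> x = (if x \<in> H then \<delta> x else \<tau> a (a + x) * \<delta> (a + x))" for x
    have \<epsilon>1: "\<epsilon> h = \<delta> h" if "h \<in> H" for h using that by (simp add: \<epsilon>_def)
    have \<epsilon>2: "\<epsilon> (a + h) = \<tau> a h * \<delta> h" if "h \<in> H" for h
      using that a by (simp add: \<epsilon>_def coset)
    have mixed: "\<epsilon> (a + h + l) = \<tau> (a + h) l * \<epsilon> (a + h) * \<epsilon> l" if hl: "h \<in> H" "l \<in> H" for h l
    proof -
      have "\<epsilon> (a + h + l) = \<tau> a (h + l) * \<tau> h l * \<delta> h * \<delta> l"
        using hl by (simp add: add.assoc \<epsilon>2 Hadd \<delta>add)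
      also have "\<dots> = \<tau> a h * \<tau> (a + h) l * \<delta> h * \<delta> l"
        using cocycle[of a h l] hl a by (simp add: mult_ac)
      finally show ?thesis using hl by (simp add: \<epsilon>1 \<epsilon>2)
    qed
    \<comment> \<open>The sum of two elements outside \<open>H\<close> falls back into
      \<open>H\<close>, where the solution is already fixed. The obstruction to consistency is
      \<open>\<tau> a a\<close>, and it vanishes by the hypothesis on the diagonal.\<close>
    have both: "\<epsilon> (h + l) = \<tau> (a + h) (a + l) * \<epsilon> (a + h) * \<epsilon> (a + l)" if hl: "h \<in> H" "l \<in> H" for h l
    proof -
      have "\<tau> (a + h) (a + l) * \<tau> a h * \<tau> a l = (\<tau> h a * \<tau> (h + a) (a + l)) * \<tau> a l"
        using hl a by (simp add: sym[of h a] add.commute mult_ac)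
      also have "\<dots> = \<tau> a (a + l) * \<tau> h (a + (a + l)) * \<tau> a l"
        using cocycle[of h a "a + l"] hl a by simp
      also have "\<dots> = \<tau> h l * (\<tau> a l * \<tau> a (a + l))"
        using hl a by (simp add: mult_ac)
      also have "\<tau> a l * \<tau> a (a + l) = 1"
        using cocycle[of a a l] hl a \<tau>0[of l] sym[of 0 l] by (simp add: diag)
      finally have "\<tau> (a + h) (a + l) * \<tau> a h * \<tau> a l = \<tau> h l" by simp
      then show ?thesis using hl by (simp add: \<epsilon>1 \<epsilon>2 Hadd \<delta>add mult_ac)
    qed
    let ?H = "H \<union> (+) a ` H"
    have "P ?H"
      unfolding P_def
    proof (intro conjI exI[of _ \<epsilon>] ballI)
      show "?H \<subseteq> T" "0 \<in> ?H" using HT H0 a by auto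
      show "\<epsilon> t \<noteq> 0" if "t \<in> ?H" for t
        using that a \<delta>nz nz by (auto simp: \<epsilon>1 \<epsilon>2)
      fix s t assume st: "s \<in> ?H" "t \<in> ?H"
      have aa: "a + h + (a + l) = h + l" for h l
        using a by (simp add: add.left_commute add.assoc)
      from st consider "s \<in> H" "t \<in> H" | h where "s = a + h" "h \<in> H" "t \<in> H"
        | l where "s \<in> H" "t = a + l" "l \<in> H" | h l where "s = a + h" "h \<in> H" "t = a + l" "l \<in> H"
        by blast
      then have "s + t \<in> ?H \<and> \<epsilon> (s + t) = \<tau> s t * \<epsilon> s * \<epsilon> t"
      proof cases
        case 1
        then show ?thesis by (simp add: \<epsilon>1 Hadd \<delta>add)
      next
        case 2
        then show ?thesis using mixed[of h t] Hadd by (simp add: add.assoc)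
      next
        case 3
        have st: "s + t = a + (l + s)" by (simp add: 3 add_ac)
        have "\<tau> s t = \<tau> (a + l) s" using 3 a sym by simp
        then show ?thesis
          unfolding st using mixed[of l s] 3 Hadd by (simp add: mult_ac add.assoc)
      next
        case 4
        then show ?thesis using both[of h l] Hadd by (simp add: aa)
      qed
      then show "s + t \<in> ?H" "\<epsilon> (s + t) = \<tau> s t * \<epsilon> s * \<epsilon> t" by blast+
    qed
    moreover have "card H < card ?H"
    proof (rule psubset_card_mono)
      show "finite ?H" using HT finite_T finite_subset by blast
      have "a + 0 \<in> ?H" using H0 by blast
      then show "H \<subset> ?H" using a(2) by auto
    qed
    ultimately show False using max[of ?H] by simp
  qed
  with H show ?thesis unfolding P_def by blast
qed

end

section \<open>Division gradings with one-dimensional components\<close>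

locale onedim_graded_algebra =
  fixes \<Gamma> :: "'g::ab_group_add \<Rightarrow> 'a::real_algebra_1 set" and k :: nat
  assumes onedim: "onedim_division_grading k \<Gamma>"
begin

abbreviation "T \<equiv> support \<Gamma>"
abbreviation "\<beta> \<equiv> grading_beta \<Gamma>"
abbreviation "\<mu> \<equiv> grading_mu \<Gamma>"

sublocale elementary_2_group T k
  using onedim by unfold_locales (auto simp: onedim_division_grading_def)

lemma subspace_component: "subspace (\<Gamma> g)"
  and decomposition: "\<exists>!c. (\<forall>g. c g \<in> \<Gamma> g) \<and> finite {g. c g \<noteq> 0} \<and> x = (\<Sum>g | c g \<noteq> 0. c g)"
  and mult_component: "x \<in> \<Gamma> g \<Longrightarrow> y \<in> \<Gamma> h \<Longrightarrow> x * y \<in> \<Gamma> (g + h)"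
  and invertible: "x \<in> \<Gamma> g \<Longrightarrow> x \<noteq> 0 \<Longrightarrow> \<exists>y. x * y = 1 \<and> y * x = 1"
  and dim_component: "g \<in> T \<Longrightarrow> dim (\<Gamma> g) = 1"
  using onedim unfolding onedim_division_grading_def division_grading_def grading_def by auto

lemma component_outside: "g \<notin> T \<Longrightarrow> \<Gamma> g = {0}"
  by (simp add: support_def)

lemma mult_nonzero:
  assumes "x \<in> \<Gamma> g" "x \<noteq> 0" "y \<noteq> 0" shows "x * y \<noteq> 0"
proof
  assume "x * y = 0"
  obtain z where "z * x = 1" using invertible assms by blast
  then have "y = z * (x * y)" by (simp flip: mult.assoc)
  with \<open>x * y = 0\<close> \<open>y \<noteq> 0\<close> show False by simp
qed

lemma component_spanned:
  assumes "t \<in> T" obtains b where "b \<noteq> 0" "\<Gamma> t = range (\<lambda>r. r *\<^sub>R b)"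
proof -
  obtain B where B: "B \<subseteq> \<Gamma> t" "independent B" "\<Gamma> t \<subseteq> span B" "card B = dim (\<Gamma> t)"
    by (rule basis_exists)
  then obtain b where b: "B = {b}" using dim_component[OF assms] by (auto simp: card_1_singleton_iff)
  have "\<Gamma> t = span B"
    using B subspace_component span_minimal by blast
  then show ?thesis
    using that[of b] B(2) b by (auto simp: span_singleton dependent_single)
qed

lemma component_eq:
  assumes "t \<in> T" "x \<in> \<Gamma> t" "x \<noteq> 0" shows "\<Gamma> t = range (\<lambda>r. r *\<^sub>R x)"
proof -
  obtain b where b: "b \<noteq> 0" "\<Gamma> t = range (\<lambda>r. r *\<^sub>R b)" using assms(1) by (rule component_spanned)
  then obtain r where r: "x = r *\<^sub>R b" using assms(2) by blast
  then have "s *\<^sub>R b = (s / r) *\<^sub>R x" for s using assms(3) by auto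
  then have "\<Gamma> t \<subseteq> range (\<lambda>r. r *\<^sub>R x)" using b(2) by auto
  moreover have "range (\<lambda>r. r *\<^sub>R x) \<subseteq> \<Gamma> t"
    using assms(2) subspace_component subspace_scale by blast
  ultimately show ?thesis by blast
qed

text \<open>The line \<open>\<Gamma> 0\<close> is closed under multiplication, so a generator
  satisfies \<open>b * b = r *\<^sub>R b\<close>; cancelling the invertible \<open>b\<close> shows
  that \<open>b\<close> is a multiple of 1.\<close>

lemma one_component: "1 \<in> \<Gamma> 0"
proof -
  obtain b where b: "b \<noteq> 0" "\<Gamma> 0 = range (\<lambda>r. r *\<^sub>R b)" using zero_mem by (rule component_spanned)
  then have "b \<in> \<Gamma> 0" by (metis rangeI scaleR_one)
  then have "b * b \<in> \<Gamma> 0" using mult_component[of b 0 b 0] by simp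
  then obtain r where r: "b * b = r *\<^sub>R b" using b by blast
  obtain y where y: "b * y = 1" using invertible \<open>b \<in> \<Gamma> 0\<close> b(1) by blast
  have "b = b * b * y" by (simp add: mult.assoc y)
  also have "\<dots> = r *\<^sub>R 1" by (simp add: r y)
  finally have "b = r *\<^sub>R 1" .
  then have "1 = inverse r *\<^sub>R b" using b(1) by auto
  then show ?thesis using b(2) by blast
qed

text \<open>As \<open>t + t = 0\<close>, the square of a generator is a nonzero real multiple of 1,
  and dividing by the square root of its absolute value leaves only the sign.\<close>

lemma normalized_element:
  assumes "t \<in> T"
  shows "\<exists>x. x \<in> \<Gamma> t \<and> (x * x = 1 \<or> x * x = -1) \<and> (t = 0 \<longrightarrow> x = 1)"
proof (cases "t = 0")
  case True
  then show ?thesis using one_component by auto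
next
  case False
  obtain b where b: "b \<noteq> 0" "\<Gamma> t = range (\<lambda>r. r *\<^sub>R b)" using assms by (rule component_spanned)
  then have bt: "b \<in> \<Gamma> t" by (metis rangeI scaleR_one)
  then have "b * b \<in> \<Gamma> 0" using mult_component[of b t b t] assms by simp
  then obtain r where r: "b * b = r *\<^sub>R 1"
    using component_eq[OF zero_mem one_component] by auto
  then have "r \<noteq> 0" using mult_nonzero[OF bt b(1) b(1)] by auto
  define x where "x = (1 / sqrt \<bar>r\<bar>) *\<^sub>R b"
  have "x * x = (1 / \<bar>r\<bar> * r) *\<^sub>R 1" by (simp add: x_def r)
  then have "x * x = 1 \<or> x * x = -1" using \<open>r \<noteq> 0\<close> by (cases "r > 0") auto
  moreover have "x \<in> \<Gamma> t" using bt subspace_component subspace_scale unfolding x_def by blast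
  ultimately show ?thesis using False by blast
qed

text \<open>For nonzero \<open>t\<close> in \<open>T\<close> the choice is unique up to sign; the
  clause at 0 makes the unit a basis vector.\<close>

definition X :: "'g \<Rightarrow> 'a" where
  "X t = (SOME x. x \<in> \<Gamma> t \<and> (x * x = 1 \<or> x * x = -1) \<and> (t = 0 \<longrightarrow> x = 1))"

lemma X_mem: "t \<in> T \<Longrightarrow> X t \<in> \<Gamma> t"
  and X_square_cases: "t \<in> T \<Longrightarrow> X t * X t = 1 \<or> X t * X t = -1"
  and X_zero [simp]: "X 0 = 1"
  using someI_ex[OF normalized_element, of t] someI_ex[OF normalized_element, OF zero_mem]
  by (auto simp: X_def)

lemma X_nonzero [simp]: "t \<in> T \<Longrightarrow> X t \<noteq> 0"
  using X_square_cases by fastforce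

lemma component_X: "t \<in> T \<Longrightarrow> \<Gamma> t = range (\<lambda>r. r *\<^sub>R X t)"
  by (simp add: component_eq X_mem)

lemma X_mult_nonzero: "s \<in> T \<Longrightarrow> t \<in> T \<Longrightarrow> X s * X t \<noteq> 0"
  by (rule mult_nonzero) (auto intro: X_mem)

subsection \<open>Coordinates\<close>

lemma expansion_exists: "\<exists>a. x = (\<Sum>t\<in>T. a t *\<^sub>R X t)"
proof -
  obtain c where c: "\<And>g. c g \<in> \<Gamma> g" "x = (\<Sum>g | c g \<noteq> 0. c g)"
    using decomposition[of x] by blast
  have "\<forall>t\<in>T. \<exists>r. c t = r *\<^sub>R X t" using c(1) component_X by blast
  then obtain a where a: "\<And>t. t \<in> T \<Longrightarrow> c t = a t *\<^sub>R X t" by metis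
  have "{g. c g \<noteq> 0} \<subseteq> T" using c(1) component_outside by blast
  then have "x = (\<Sum>t\<in>T. c t)" unfolding c(2) by (intro sum.mono_neutral_left) auto
  then show ?thesis using a by (intro exI[of _ a]) simp
qed

lemma expansion_unique:
  assumes eq: "(\<Sum>t\<in>T. a t *\<^sub>R X t) = (\<Sum>t\<in>T. b t *\<^sub>R X t)" and t: "t \<in> T"
  shows "a t = b t"
proof -
  define c where "c a g = (if g \<in> T then a g *\<^sub>R X g else 0)" for a g
  have c: "(\<forall>g. c a g \<in> \<Gamma> g) \<and> finite {g. c a g \<noteq> 0} \<and>
      (\<Sum>t\<in>T. a t *\<^sub>R X t) = (\<Sum>g | c a g \<noteq> 0. c a g)" for a
  proof (intro conjI allI)
    show "c a g \<in> \<Gamma> g" for g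
      using X_mem subspace_component by (auto simp: c_def subspace_scale subspace_0)
    have sub: "{g. c a g \<noteq> 0} \<subseteq> T" by (auto simp: c_def)
    then show "finite {g. c a g \<noteq> 0}" by (rule finite_subset) simp
    have "(\<Sum>t\<in>T. a t *\<^sub>R X t) = (\<Sum>t\<in>T. c a t)" by (simp add: c_def)
    also have "\<dots> = (\<Sum>g | c a g \<noteq> 0. c a g)"
      using sub by (intro sum.mono_neutral_right) auto
    finally show "(\<Sum>t\<in>T. a t *\<^sub>R X t) = (\<Sum>g | c a g \<noteq> 0. c a g)" .
  qed
  have "c a = c b"
    using decomposition[of "\<Sum>t\<in>T. a t *\<^sub>R X t"] c[of a] c[of b, folded eq] by blast
  then have "c a t = c b t" by simp
  then show ?thesis using t by (simp add: c_def)
qed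

text \<open>Only the values on \<open>T\<close> are determined by \<open>x\<close>; uniqueness of
  the expansion makes the choice harmless there.\<close>

definition coord :: "'a \<Rightarrow> 'g \<Rightarrow> real" where
  "coord x = (SOME a. x = (\<Sum>t\<in>T. a t *\<^sub>R X t))"

lemma expansion: "x = (\<Sum>t\<in>T. coord x t *\<^sub>R X t)"
  unfolding coord_def by (rule someI_ex[OF expansion_exists])

lemma coord_sum: "t \<in> T \<Longrightarrow> coord (\<Sum>t\<in>T. a t *\<^sub>R X t) t = a t"
  by (rule expansion_unique[OF expansion[symmetric]])

lemma linear_coord: 
  assumes "t \<in> T" shows "linear (\<lambda>x. coord x t)"
proof (rule linearI)
  fix x y r
  have "x + y = (\<Sum>t\<in>T. (coord x t + coord y t) *\<^sub>R X t)"
    by (simp add: scaleR_add_left sum.distrib flip: expansion)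
  then show "coord (x + y) t = coord x t + coord y t"
    using coord_sum[OF assms, of "\<lambda>t. coord x t + coord y t"] by simp
  have "r *\<^sub>R x = (\<Sum>t\<in>T. (r * coord x t) *\<^sub>R X t)"
    by (simp flip: scaleR_scaleR scaleR_sum_right expansion)
  then show "coord (r *\<^sub>R x) t = r *\<^sub>R coord x t"
    using coord_sum[OF assms, of "\<lambda>t. r * coord x t"] by simp
qed

lemma coord_X: 
  assumes "s \<in> T" "t \<in> T" shows "coord (X s) t = (if s = t then 1 else 0)"
proof -
  have "X s = (\<Sum>t\<in>T. (if s = t then 1 else 0) *\<^sub>R X t)"
    using assms(1) by (simp add: if_distrib[of "\<lambda>r. r *\<^sub>R _"] cong: if_cong)
  then show ?thesis using coord_sum[OF assms(2), of "\<lambda>t. if s = t then 1 else 0"] by simp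
qed

lemma X_inj: "s \<in> T \<Longrightarrow> t \<in> T \<Longrightarrow> c *\<^sub>R X s = d *\<^sub>R X t \<Longrightarrow> c \<noteq> 0 \<Longrightarrow> s = t"
  using linear_cmul[OF linear_coord[of s], of c "X s"] linear_cmul[OF linear_coord[of s], of d "X t"]
  by (auto simp: coord_X split: if_splits)

lemma component_disjoint: "x \<in> \<Gamma> s \<Longrightarrow> x \<in> \<Gamma> t \<Longrightarrow> x \<noteq> 0 \<Longrightarrow> s = t"
  using component_outside[of s] component_outside[of t] component_X[of s] component_X[of t] X_inj
  by (smt (verit, best) imageE scale_eq_0_iff singletonD)

lemma span_X: "span (X ` T) = UNIV"
proof -
  have "(\<Sum>t\<in>T. coord x t *\<^sub>R X t) \<in> span (X ` T)" for x
    by (intro span_sum span_scale span_base imageI)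
  then show ?thesis using expansion by (metis UNIV_eq_I)
qed

lemma linear_eq_on_X:
  assumes "linear F" "linear G" "\<And>t. t \<in> T \<Longrightarrow> F (X t) = G (X t)"
  shows "F x = G x"
  by (rule linear_eq_on_span[of F G "X ` T"]) (use assms in \<open>auto simp: span_X\<close>)

lemma bilinear_eq_on_X:
  assumes "bilinear F" "bilinear G" "\<And>s t. s \<in> T \<Longrightarrow> t \<in> T \<Longrightarrow> F (X s) (X t) = G (X s) (X t)"
  shows "F x y = G x y"
  by (rule bilinear_eq[of F G UNIV "X ` T" UNIV "X ` T"]) (use assms in \<open>auto simp: span_X\<close>)

definition extend :: "('g \<Rightarrow> 'b::real_vector) \<Rightarrow> 'a \<Rightarrow> 'b" where
  "extend Y x = (\<Sum>t\<in>T. coord x t *\<^sub>R Y t)"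

lemma linear_extend: "linear (extend Y)"
  unfolding extend_def
  by (rule linear_compose_sum) (auto intro!: linearI simp: linear_add[OF linear_coord] linear_cmul[OF linear_coord] scaleR_add_left)

lemma extend_X [simp]:
  assumes "s \<in> T" shows "extend Y (X s) = Y s"
proof -
  have "extend Y (X s) = (\<Sum>t\<in>T. if s = t then Y t else 0)"
    unfolding extend_def by (rule sum.cong) (auto simp: coord_X assms)
  then show ?thesis using assms by simp
qed

subsection \<open>The bicharacter and the quadratic form of the grading\<close>

text \<open>The group is abelian, so both products are nonzero elements of the same line
  \<open>\<Gamma> (u + v)\<close>.\<close>

lemma commutation_exists:
  assumes "u \<in> T" "v \<in> T" obtains b where "b \<noteq> 0" "X u * X v = b *\<^sub>R (X v * X u)"
proof -
  have "X u * X v \<in> \<Gamma> (u + v)" "X v * X u \<in> \<Gamma> (u + v)"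
    using mult_component[of "X u" u "X v" v] mult_component[of "X v" v "X u" u] X_mem assms
    by (auto simp: add.commute)
  then obtain b where b: "X u * X v = b *\<^sub>R (X v * X u)"
    using component_eq[of "u + v" "X v * X u"] assms X_mult_nonzero by auto
  moreover have "b \<noteq> 0" using b X_mult_nonzero[OF assms] by auto
  ultimately show ?thesis using that by blast
qed

text \<open>One pair of basis vectors decides the value, since scaling a factor scales both products
  alike.\<close>

lemma \<beta>_eq:
  assumes uv: "u \<in> T" "v \<in> T" and b: "X u * X v = b *\<^sub>R (X v * X u)"
  shows "\<beta> u v = b"
  unfolding grading_beta_def
proof (rule the_equality)
  show "\<forall>x\<in>\<Gamma> u - {0}. \<forall>y\<in>\<Gamma> v - {0}. x * y = b *\<^sub>R (y * x)"
    using uv by (auto simp: component_X b mult_ac)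
  show "b' = b" if "\<forall>x\<in>\<Gamma> u - {0}. \<forall>y\<in>\<Gamma> v - {0}. x * y = b' *\<^sub>R (y * x)" for b'
  proof -
    have "X u * X v = b' *\<^sub>R (X v * X u)" using that uv X_mem X_nonzero by blast
    with b show ?thesis using X_mult_nonzero[OF uv(2,1)] by auto
  qed
qed

lemma X_commute: "u \<in> T \<Longrightarrow> v \<in> T \<Longrightarrow> X u * X v = \<beta> u v *\<^sub>R (X v * X u)"
  using \<beta>_eq commutation_exists by metis

lemma component_commute:
  "u \<in> T \<Longrightarrow> v \<in> T \<Longrightarrow> x \<in> \<Gamma> u \<Longrightarrow> y \<in> \<Gamma> v \<Longrightarrow> x * y = \<beta> u v *\<^sub>R (y * x)"
  using X_commute[of u v] by (auto simp: component_X mult_ac)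

text \<open>Any other nonzero element of the component is \<open>r *\<^sub>R x\<close>, so its
  square changes by the positive factor \<open>r * r\<close>. The factor \<open>d\<close> lets
  \<open>x\<close> be any nonzero element, normalized or not.\<close>

lemma \<mu>_eq:
  assumes t: "t \<in> T" and s: "s \<in> {1, -1}" and sq: "x \<in> \<Gamma> t" "x * x = (d * s) *\<^sub>R 1" "d > 0"
  shows "\<mu> t = s"
proof -
  have x: "x \<noteq> 0" using sq s by auto
  have "(THE s. s \<in> {1, -1} \<and> (\<forall>y\<in>\<Gamma> t - {0}. \<exists>c>0. y * y = c *\<^sub>R (s *\<^sub>R 1))) = s"
  proof (rule the_equality)
    show "s \<in> {1, -1} \<and> (\<forall>y\<in>\<Gamma> t - {0}. \<exists>c>0. y * y = c *\<^sub>R (s *\<^sub>R 1))"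
    proof (intro conjI s ballI)
      fix y assume "y \<in> \<Gamma> t - {0}"
      then obtain r where "y = r *\<^sub>R x" "r \<noteq> 0" using component_eq[OF t sq(1) x] by auto
      then have "r * r * d > 0" "y * y = (r * r * d) *\<^sub>R (s *\<^sub>R 1)"
        using sq(2,3) by (auto simp: mult_ac zero_less_mult_iff)
      then show "\<exists>c>0. y * y = c *\<^sub>R (s *\<^sub>R 1)" by blast
    qed
    fix s' :: real assume s': "s' \<in> {1, -1} \<and> (\<forall>y\<in>\<Gamma> t - {0}. \<exists>c>0. y * y = c *\<^sub>R (s' *\<^sub>R 1))"
    then obtain c where "c > 0" "x * x = c *\<^sub>R (s' *\<^sub>R 1)"
      using sq(1) x by blast
    then have "d * s = c * s'" using sq(2) by simp
    then show "s' = s" using s s' \<open>c > 0\<close> sq(3) by auto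
  qed
  then show ?thesis using t by (simp add: grading_mu_def)
qed

lemma \<mu>_sign: "t \<in> T \<Longrightarrow> \<mu> t \<in> {1, -1}"
  and X_square: "t \<in> T \<Longrightarrow> X t * X t = \<mu> t *\<^sub>R 1"
  using X_square_cases[of t] \<mu>_eq[of t 1 "X t" 1] \<mu>_eq[of t "-1" "X t" 1] X_mem[of t] by auto

lemma component_square:
  assumes "t \<in> T" "x \<in> \<Gamma> t - {0}"
  shows "\<exists>c>0. x * x = c *\<^sub>R (\<mu> t *\<^sub>R 1)"
proof -
  obtain r where "x = r *\<^sub>R X t" "r \<noteq> 0" using assms component_X by auto
  then have "r * r > 0" "x * x = (r * r) *\<^sub>R (\<mu> t *\<^sub>R 1)"
    using X_square[OF assms(1)] by (auto simp: zero_less_mult_iff)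
  then show ?thesis by blast
qed

text \<open>The 2-cocycle that presents the algebra as a twisted group algebra of \<open>T\<close>,
  read off as a coordinate of the product.\<close>

definition \<sigma> :: "'g \<Rightarrow> 'g \<Rightarrow> real" where
  "\<sigma> s t = coord (X s * X t) (s + t)"

lemma X_mult:
  assumes "s \<in> T" "t \<in> T" shows "X s * X t = \<sigma> s t *\<^sub>R X (s + t)"
proof -
  have "X s * X t \<in> \<Gamma> (s + t)" using assms X_mem mult_component by blast
  then obtain r where r: "X s * X t = r *\<^sub>R X (s + t)" using component_X assms by auto
  then have "\<sigma> s t = r" using assms linear_cmul[OF linear_coord] by (simp add: \<sigma>_def coord_X)
  with r show ?thesis by simp
qed

lemma \<sigma>_nonzero: "s \<in> T \<Longrightarrow> t \<in> T \<Longrightarrow> \<sigma> s t \<noteq> 0"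
  using X_mult X_mult_nonzero by fastforce

lemma \<sigma>_diag: "t \<in> T \<Longrightarrow> \<sigma> t t = \<mu> t"
  using X_mult[of t t] X_square[of t] by simp

lemma \<sigma>_commute: 
  assumes "s \<in> T" "t \<in> T" shows "\<sigma> s t = \<beta> s t * \<sigma> t s"
proof -
  have "\<sigma> s t *\<^sub>R X (s + t) = (\<beta> s t * \<sigma> t s) *\<^sub>R X (s + t)"
    using X_commute[OF assms] X_mult assms by (simp add: add.commute)
  then show ?thesis using assms by simp
qed

lemma \<sigma>_cocycle:
  assumes "s \<in> T" "t \<in> T" "u \<in> T"
  shows "\<sigma> s t * \<sigma> (s + t) u = \<sigma> t u * \<sigma> s (t + u)"
proof -
  have "(\<sigma> s t * \<sigma> (s + t) u) *\<^sub>R X (s + t + u) = X s * X t * X u"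
    using assms by (simp add: X_mult)
  also have "\<dots> = X s * (X t * X u)" by (rule mult.assoc)
  also have "\<dots> = (\<sigma> t u * \<sigma> s (t + u)) *\<^sub>R X (s + t + u)"
    using assms by (simp add: X_mult add.assoc)
  finally show ?thesis using assms by simp
qed

text \<open>Moving \<open>X u\<close> past \<open>X v * X w\<close> one factor at a time gives
  multiplicativity on the right. Interchanging twice gives
  \<open>\<beta> u v * \<beta> v u = 1\<close>, which transfers it to the left.\<close>

lemma alternating_bicharacter_\<beta>: "alternating_bicharacter T \<beta>"
proof -
  have right: "\<beta> u (v + w) = \<beta> u v * \<beta> u w" if uvw: "u \<in> T" "v \<in> T" "w \<in> T" for u v w
  proof (rule \<beta>_eq)
    have "\<sigma> v w *\<^sub>R (X u * X (v + w)) = X u * X v * X w"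
      using uvw by (simp add: X_mult[of v w] mult.assoc)
    also have "\<dots> = \<beta> u v *\<^sub>R (X v * (X u * X w))"
      using X_commute[of u v] uvw by (simp add: mult.assoc)
    also have "\<dots> = (\<beta> u v * \<beta> u w) *\<^sub>R (X v * X w * X u)"
      using X_commute[of u w] uvw by (simp add: mult.assoc)
    also have "\<dots> = \<sigma> v w *\<^sub>R ((\<beta> u v * \<beta> u w) *\<^sub>R (X (v + w) * X u))"
      using uvw by (simp add: X_mult[of v w] mult_ac)
    finally show "X u * X (v + w) = (\<beta> u v * \<beta> u w) *\<^sub>R (X (v + w) * X u)"
      using \<sigma>_nonzero uvw by (metis scaleR_cancel_left)
  qed (use uvw in auto)
  have inv: "\<beta> u v * \<beta> v u = 1" if uv: "u \<in> T" "v \<in> T" for u v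
  proof -
    have "X u * X v = (\<beta> u v * \<beta> v u) *\<^sub>R (X u * X v)"
      using X_commute[OF uv] X_commute[OF uv(2,1)] by (metis scaleR_scaleR)
    then have "(1 - \<beta> u v * \<beta> v u) *\<^sub>R (X u * X v) = 0" by (simp add: scaleR_diff_left)
    then show ?thesis using X_mult_nonzero[OF uv] by simp
  qed
  have left: "\<beta> (u + v) w = \<beta> u w * \<beta> v w" if uvw: "u \<in> T" "v \<in> T" "w \<in> T" for u v w
  proof -
    have "\<beta> (u + v) w * (\<beta> w u * \<beta> w v) = 1"
      using inv[of "u + v" w] right[of w u v] uvw by simp
    moreover have "(\<beta> u w * \<beta> v w) * (\<beta> w u * \<beta> w v) = 1"
      using inv[of u w] inv[of v w] uvw by (simp add: mult_ac mult.left_commute)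
    ultimately show ?thesis by (metis mult_cancel_right zero_neq_one mult_zero_right)
  qed
  have "\<beta> u v \<noteq> 0" if "u \<in> T" "v \<in> T" for u v using inv[OF that] by auto
  moreover have "\<beta> u u = 1" if "u \<in> T" for u using \<beta>_eq[OF that that, of 1] by simp
  ultimately show ?thesis using left right by (simp add: alternating_bicharacter_def)
qed

sublocale alternating_form T k \<beta>
  by unfold_locales (rule alternating_bicharacter_\<beta>)

text \<open>The square of \<open>X u * X v\<close> is computed twice: as
  \<open>\<sigma> u v * \<sigma> u v * \<mu> (u + v)\<close>, and, after interchanging the inner
  factors, as \<open>\<mu> u * \<mu> v * \<beta> u v\<close>. The square of
  \<open>\<sigma> u v\<close> is positive and all else is a sign, so the signs agree.\<close>

lemma \<mu>_quadratic_form: "\<mu> \<in> quadratic_forms T \<beta>"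
proof (rule quadratic_formsI)
  show "\<mu> \<in> T \<rightarrow>\<^sub>E {1, -1}"
    using \<mu>_sign by (auto simp: grading_mu_def PiE_iff extensional_def)
  fix u v assume uv: "u \<in> T" "v \<in> T"
  have "(\<sigma> u v * \<sigma> u v * \<mu> (u + v)) *\<^sub>R 1 = (X u * X v) * (X u * X v)"
    using uv by (simp add: X_mult[of u v] X_square[of "u + v"])
  also have "\<dots> = X u * (X v * X u) * X v" by (simp add: mult.assoc)
  also have "\<dots> = \<beta> v u *\<^sub>R (X u * X u * (X v * X v))"
    using X_commute[OF uv(2,1)] by (simp add: mult.assoc)
  also have "\<dots> = (\<mu> u * \<mu> v * \<beta> u v) *\<^sub>R 1"
    using uv \<beta>_sym by (simp add: X_square mult_ac)
  finally have eq: "\<sigma> u v * \<sigma> u v * \<mu> (u + v) = \<mu> u * \<mu> v * \<beta> u v" by simp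
  have "\<sigma> u v * \<sigma> u v > 0" using \<sigma>_nonzero[OF uv] by (simp add: zero_less_mult_iff) linarith
  then show "\<mu> (u + v) = \<mu> u * \<mu> v * \<beta> u v"
    using eq \<mu>_sign[of u] \<mu>_sign[of v] \<mu>_sign[of "u + v"] \<beta>_sign[OF uv] uv by auto
qed

end

context onedim_graded_algebra
begin

subsection \<open>Involutions\<close>

lemma bilinear_anticomm: "linear \<phi> \<Longrightarrow> bilinear (\<lambda>x y. \<phi> y * \<phi> x)"
  and bilinear_hom: "linear \<psi> \<Longrightarrow> bilinear (\<lambda>x y. \<psi> x * \<psi> y)"
  and bilinear_comp: "linear \<psi> \<Longrightarrow> bilinear (\<lambda>x y. \<psi> (x * y))"
  for \<phi> \<psi> :: "'a \<Rightarrow> 'b::real_algebra_1"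
  by (auto simp: bilinear_def linear_iff algebra_simps)

lemma corresponds_iff:
  assumes "linear \<phi>"
  shows "corresponds \<Gamma> \<phi> \<eta> \<longleftrightarrow> (\<forall>t\<in>T. \<phi> (X t) = \<eta> t *\<^sub>R X t)"
proof
  show "corresponds \<Gamma> \<phi> \<eta> \<Longrightarrow> \<forall>t\<in>T. \<phi> (X t) = \<eta> t *\<^sub>R X t"
    using X_mem by (auto simp: corresponds_def)
  show "\<forall>t\<in>T. \<phi> (X t) = \<eta> t *\<^sub>R X t \<Longrightarrow> corresponds \<Gamma> \<phi> \<eta>"
    using linear_cmul[OF assms] by (auto simp: corresponds_def component_X)
qed

lemma graded_involutionsD:
  assumes "\<phi> \<in> graded_involutions \<Gamma>"
  shows "linear \<phi>" "\<And>x y. \<phi> (x * y) = \<phi> y * \<phi> x" "\<And>x. \<phi> (\<phi> x) = x"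
    "\<And>g x. x \<in> \<Gamma> g \<Longrightarrow> \<phi> x \<in> \<Gamma> g"
  using assms unfolding graded_involutions_def by blast+

text \<open>\<open>\<phi>\<close> maps each line \<open>\<Gamma> t\<close> to itself, so
  \<open>X t\<close> is an eigenvector, with eigenvalue 1 or -1 because \<open>\<phi>\<close> is its
  own inverse. Reversing the product \<open>X u * X v\<close> brings in \<open>\<beta> u v\<close>,
  which yields the polarization identity.\<close>

lemma involution_form_exists:
  assumes \<phi>: "\<phi> \<in> graded_involutions \<Gamma>"
  obtains \<eta> where "\<eta> \<in> quadratic_forms T \<beta>" "corresponds \<Gamma> \<phi> \<eta>"
proof -
  note \<phi>D = graded_involutionsD[OF \<phi>]
  have "\<forall>t\<in>T. \<exists>r. \<phi> (X t) = r *\<^sub>R X t"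
    using \<phi>D(4) component_X X_mem by blast
  then obtain r where r: "\<And>t. t \<in> T \<Longrightarrow> \<phi> (X t) = r t *\<^sub>R X t" by metis
  \<comment> \<open>Members of \<open>quadratic_forms\<close> are extensional, hence the
    restriction.\<close>
  define \<eta> where "\<eta> = restrict r T"
  have \<eta>: "\<phi> (X t) = \<eta> t *\<^sub>R X t" if "t \<in> T" for t using r that by (simp add: \<eta>_def)
  have sign: "\<eta> t \<in> {1, -1}" if "t \<in> T" for t
  proof -
    have "X t = (\<eta> t * \<eta> t) *\<^sub>R X t"
      using \<phi>D(3)[of "X t"] that by (simp add: \<eta> linear_cmul[OF \<phi>D(1)])
    then have "(\<eta> t * \<eta> t - 1) *\<^sub>R X t = 0" by (simp add: scaleR_diff_left)
    then show ?thesis using that by (auto simp: square_eq_1_iff)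
  qed
  have "\<eta> \<in> quadratic_forms T \<beta>"
  proof (rule quadratic_formsI)
    show "\<eta> \<in> T \<rightarrow>\<^sub>E {1, -1}" using sign by (auto simp: \<eta>_def)
    fix u v assume uv: "u \<in> T" "v \<in> T"
    have "(\<sigma> u v * \<eta> (u + v)) *\<^sub>R X (u + v) = \<phi> (X u * X v)"
      using uv by (simp add: X_mult \<eta> linear_cmul[OF \<phi>D(1)])
    also have "\<dots> = (\<eta> u * \<eta> v) *\<^sub>R (X v * X u)"
      using uv by (simp add: \<phi>D(2) \<eta> mult_ac)
    also have "X v * X u = \<beta> u v *\<^sub>R (X u * X v)"
      using X_commute[OF uv(2,1)] \<beta>_sym[OF uv] by simp
    also have "(\<eta> u * \<eta> v) *\<^sub>R \<dots> = (\<sigma> u v * (\<eta> u * \<eta> v * \<beta> u v)) *\<^sub>R X (u + v)"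
      using uv by (simp add: X_mult mult_ac)
    finally show "\<eta> (u + v) = \<eta> u * \<eta> v * \<beta> u v"
      using uv \<sigma>_nonzero by simp
  qed
  moreover have "corresponds \<Gamma> \<phi> \<eta>" using \<eta> \<phi>D(1) by (simp add: corresponds_iff)
  ultimately show ?thesis by (rule that)
qed

lemma corresponding_form_unique:
  assumes "linear \<phi>" "corresponds \<Gamma> \<phi> \<eta>" "corresponds \<Gamma> \<phi> \<eta>'"
    "\<eta> \<in> quadratic_forms T \<beta>" "\<eta>' \<in> quadratic_forms T \<beta>"
  shows "\<eta> = \<eta>'"
proof (rule PiE_ext[OF quadratic_formsD(1)[OF assms(4)] quadratic_formsD(1)[OF assms(5)]])
  fix t assume t: "t \<in> T"
  then have "\<eta> t *\<^sub>R X t = \<eta>' t *\<^sub>R X t"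
    using assms(1-3) by (simp add: corresponds_iff)
  then show "\<eta> t = \<eta>' t" using t by simp
qed

text \<open>The map is diagonal in the basis \<open>X t\<close>. The polarization identity is what
  makes it reverse products of basis vectors, and sign values make it its own inverse.\<close>

lemma form_involution_exists:
  assumes \<eta>: "\<eta> \<in> quadratic_forms T \<beta>"
  obtains \<phi> where "\<phi> \<in> graded_involutions \<Gamma>" "corresponds \<Gamma> \<phi> \<eta>"
proof -
  note \<eta>D = quadratic_formsD[OF \<eta>]
  define \<phi> where "\<phi> = extend (\<lambda>t. \<eta> t *\<^sub>R X t)"
  have lin: "linear \<phi>" unfolding \<phi>_def by (rule linear_extend)
  have X: "\<phi> (X t) = \<eta> t *\<^sub>R X t" if "t \<in> T" for t using that by (simp add: \<phi>_def)
  have cor: "corresponds \<Gamma> \<phi> \<eta>" using X lin by (simp add: corresponds_iff)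
  have idem: "\<phi> (\<phi> x) = x" for x
  proof (rule linear_eq_on_X[of "\<lambda>x. \<phi> (\<phi> x)" "\<lambda>x. x"])
    show "linear (\<lambda>x. \<phi> (\<phi> x))" using linear_compose[OF lin lin] by (simp add: o_def)
    show "linear (\<lambda>x :: 'a. x)" by (simp add: linear_iff)
    show "\<phi> (\<phi> (X t)) = X t" if "t \<in> T" for t
      using \<eta>D(2)[OF that] that by (auto simp: X linear_cmul[OF lin] linear_neg[OF lin])
  qed
  have anti: "\<phi> (x * y) = \<phi> y * \<phi> x" for x y
  proof (rule bilinear_eq_on_X[of "\<lambda>x y. \<phi> (x * y)" "\<lambda>x y. \<phi> y * \<phi> x"])
    show "bilinear (\<lambda>x y. \<phi> (x * y))" "bilinear (\<lambda>x y. \<phi> y * \<phi> x)"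
      using lin by (auto intro: bilinear_anticomm bilinear_comp)
    fix s t assume st: "s \<in> T" "t \<in> T"
    have "\<phi> (X s * X t) = (\<eta> s * \<eta> t * \<beta> t s) *\<^sub>R (X s * X t)"
      using st \<beta>_sym by (simp add: X_mult linear_cmul[OF lin] X \<eta>D(3) mult_ac)
    also have "\<dots> = (\<eta> s * \<eta> t) *\<^sub>R (X t * X s)"
      using X_commute[OF st(2,1)] by simp
    finally show "\<phi> (X s * X t) = \<phi> (X t) * \<phi> (X s)"
      using st by (simp add: X mult_ac)
  qed
  have "\<phi> ` \<Gamma> g \<subseteq> \<Gamma> g" for g
  proof (cases "g \<in> T")
    case True
    then show ?thesis
      using cor subspace_component[of g] by (auto simp: corresponds_def subspace_scale)
  next
    case False
    then show ?thesis using linear_0[OF lin] by (simp add: component_outside)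
  qed
  moreover have "bij \<phi>" using idem by (rule involuntory_imp_bij)
  ultimately have "\<phi> \<in> graded_involutions \<Gamma>"
    using lin anti idem by (simp add: graded_involutions_def)
  with cor show ?thesis by (rule that[rotated])
qed

lemma corresponding_involution_unique:
  assumes "linear \<phi>" "linear \<phi>'" "corresponds \<Gamma> \<phi> \<eta>" "corresponds \<Gamma> \<phi>' \<eta>"
  shows "\<phi> = \<phi>'"
proof
  show "\<phi> x = \<phi>' x" for x
    by (rule linear_eq_on_X) (use assms in \<open>auto simp: corresponds_iff\<close>)
qed

subsection \<open>Algebra isomorphisms\<close>

lemma alg_isoD:
  assumes "alg_iso \<psi>"
  shows "linear \<psi>" "bij \<psi>" "\<psi> 1 = 1" "\<And>x y. \<psi> (x * y) = \<psi> x * \<psi> y" "\<And>x. \<psi> x = 0 \<longleftrightarrow> x = 0"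
  using assms linear_injective_0[of \<psi>] linear_0[of \<psi>] by (auto simp: alg_iso_def bij_def)

lemma image_component:
  assumes "linear \<psi>" "t \<in> T" shows "\<psi> ` \<Gamma> t = range (\<lambda>r. r *\<^sub>R \<psi> (X t))"
  using assms by (auto simp: component_X linear_cmul image_iff)

end

section \<open>Isomorphism classes of pairs\<close>

text \<open>\<open>\<psi>\<close> carries \<open>\<Gamma> t\<close> onto \<open>\<Gamma>' t\<close>
  and respects squares and the eigenvalues of the involutions, so the supports and the signs at each
  \<open>t\<close> agree.\<close>

lemma isomorphic_pairs_imp:
  assumes \<Gamma>: "onedim_division_grading k \<Gamma>" and \<Gamma>': "onedim_division_grading k \<Gamma>'"
    and \<phi>: "linear \<phi>" "corresponds \<Gamma> \<phi> \<eta>" "\<eta> \<in> quadratic_forms (support \<Gamma>) (grading_beta \<Gamma>)"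
    and \<phi>': "linear \<phi>'" "corresponds \<Gamma>' \<phi>' \<eta>'" "\<eta>' \<in> quadratic_forms (support \<Gamma>') (grading_beta \<Gamma>')"
    and iso: "isomorphic_pairs \<Gamma> \<phi> \<Gamma>' \<phi>'"
  shows "support \<Gamma>' = support \<Gamma> \<and> grading_mu \<Gamma>' = grading_mu \<Gamma> \<and> \<eta>' = \<eta>"
proof -
  interpret A: onedim_graded_algebra \<Gamma> k by unfold_locales (rule \<Gamma>)
  interpret B: onedim_graded_algebra \<Gamma>' k by unfold_locales (rule \<Gamma>')
  obtain \<psi> where \<psi>: "alg_iso \<psi>" "\<phi>' \<circ> \<psi> = \<psi> \<circ> \<phi>" and im: "\<And>g. \<psi> ` \<Gamma> g = \<Gamma>' g"
    using iso unfolding isomorphic_pairs_def by blast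
  note \<psi>D = A.alg_isoD[OF \<psi>(1)]
  have "\<Gamma>' g = {0} \<longleftrightarrow> \<Gamma> g = {0}" for g
  proof -
    have "\<psi> ` \<Gamma> g \<subseteq> {0} \<longleftrightarrow> \<Gamma> g \<subseteq> {0}" using \<psi>D(5) by auto
    moreover have "\<Gamma> g \<noteq> {}" using A.subspace_component[of g] subspace_0 by blast
    ultimately show ?thesis unfolding im[symmetric] by (simp add: subset_singleton_iff)
  qed
  then have T: "support \<Gamma>' = support \<Gamma>" by (simp add: support_def)
  have mem: "\<psi> (A.X t) \<in> \<Gamma>' t" if "t \<in> support \<Gamma>" for t
    using im A.X_mem that by blast
  have \<mu>: "grading_mu \<Gamma>' t = grading_mu \<Gamma> t" if "t \<in> support \<Gamma>" for t
  proof (rule B.\<mu>_eq)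
    show "\<psi> (A.X t) * \<psi> (A.X t) = (1 * grading_mu \<Gamma> t) *\<^sub>R 1"
      using that \<psi>D by (simp add: A.X_square linear_cmul flip: \<psi>D(4))
  qed (use that T A.\<mu>_sign mem in auto)
  have "grading_mu \<Gamma>' = grading_mu \<Gamma>"
    by (rule PiE_ext[OF B.quadratic_formsD(1)[OF B.\<mu>_quadratic_form, unfolded T]
          A.quadratic_formsD(1)[OF A.\<mu>_quadratic_form] \<mu>])
  moreover have "\<eta>' = \<eta>"
  proof (rule PiE_ext[OF B.quadratic_formsD(1)[OF \<phi>'(3), unfolded T]
        A.quadratic_formsD(1)[OF \<phi>(3)]])
    fix t assume t: "t \<in> support \<Gamma>"
    have "\<eta>' t *\<^sub>R \<psi> (A.X t) = \<phi>' (\<psi> (A.X t))"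
      using \<phi>'(2) mem[OF t] t T by (simp add: corresponds_def)
    also have "\<dots> = \<psi> (\<phi> (A.X t))" using \<psi>(2) by (metis o_apply)
    also have "\<dots> = \<eta> t *\<^sub>R \<psi> (A.X t)"
      using t \<phi>(1,2) \<psi>D(1) by (simp add: A.corresponds_iff linear_cmul)
    finally show "\<eta>' t = \<eta> t" using t \<psi>D(5) by simp
  qed
  ultimately show ?thesis using T by blast
qed

lemma isomorphic_pairs_of_forms_eq:
  assumes \<Gamma>: "onedim_division_grading k \<Gamma>" and \<Gamma>': "onedim_division_grading k \<Gamma>'"
    and T: "support \<Gamma>' = support \<Gamma>" and \<mu>: "grading_mu \<Gamma>' = grading_mu \<Gamma>"
    and \<phi>: "linear \<phi>" "corresponds \<Gamma> \<phi> \<eta>" and \<phi>': "linear \<phi>'" "corresponds \<Gamma>' \<phi>' \<eta>"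
  shows "isomorphic_pairs \<Gamma> \<phi> \<Gamma>' \<phi>'"
proof -
  interpret A: onedim_graded_algebra \<Gamma> k by unfold_locales (rule \<Gamma>)
  interpret B: onedim_graded_algebra \<Gamma>' k by unfold_locales (rule \<Gamma>')
  let ?T = "support \<Gamma>"
  \<comment> \<open>As polarizations of the same form, the two commutation factors agree.\<close>
  have \<beta>: "grading_beta \<Gamma>' s t = grading_beta \<Gamma> s t" if "s \<in> ?T" "t \<in> ?T" for s t
  proof -
    have "grading_mu \<Gamma> s * grading_mu \<Gamma> t * grading_beta \<Gamma>' s t =
      grading_mu \<Gamma> s * grading_mu \<Gamma> t * grading_beta \<Gamma> s t"
      using A.quadratic_formsD(3)[OF A.\<mu>_quadratic_form that]
        B.quadratic_formsD(3)[OF B.\<mu>_quadratic_form, unfolded T \<mu>, OF that] by simp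
    then show ?thesis using A.\<mu>_sign[OF that(1)] A.\<mu>_sign[OF that(2)] by auto
  qed
  note B = B.\<sigma>_commute[unfolded T] B.\<sigma>_cocycle[unfolded T] B.\<sigma>_nonzero[unfolded T]
    B.\<sigma>_diag[unfolded T \<mu>]
  \<comment> \<open>In the quotient the common factor \<open>\<beta> s t\<close> cancels, which
    makes it symmetric, and the diagonals, both given by \<open>\<mu>\<close>, cancel to 1.\<close>
  let ?\<tau> = "\<lambda>s t. B.\<sigma> s t / A.\<sigma> s t"
  have nz: "?\<tau> s t \<noteq> 0" if "s \<in> ?T" "t \<in> ?T" for s t
    using that A.\<sigma>_nonzero B(3) by simp
  have sym: "?\<tau> s t = ?\<tau> t s" if "s \<in> ?T" "t \<in> ?T" for s t
    using A.\<sigma>_commute[OF that] B(1)[OF that] \<beta>[OF that] A.\<beta>_nonzero[OF that] by simp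
  have cocycle: "?\<tau> s t * ?\<tau> (s + t) u = ?\<tau> t u * ?\<tau> s (t + u)"
    if "s \<in> ?T" "t \<in> ?T" "u \<in> ?T" for s t u
    using that by (simp add: A.\<sigma>_cocycle B(2))
  have diag: "?\<tau> t t = 1" if "t \<in> ?T" for t
    using that A.\<mu>_sign[OF that] by (auto simp: A.\<sigma>_diag B(4))
  obtain \<delta> where \<delta>nz: "\<And>t. t \<in> ?T \<Longrightarrow> \<delta> t \<noteq> 0"
    and \<delta>: "\<And>s t. s \<in> ?T \<Longrightarrow> t \<in> ?T \<Longrightarrow> \<delta> (s + t) = ?\<tau> s t * \<delta> s * \<delta> t"
    using A.symmetric_cocycle_trivial[of ?\<tau>, OF nz sym cocycle diag] by blast
  \<comment> \<open>Rescaling by \<open>\<delta>\<close> turns the first structure constants into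
    the second, so \<open>\<psi>\<close> is multiplicative. It intertwines the involutions because
    both act by \<open>\<eta> t\<close> on the component at \<open>t\<close>.\<close>
  define \<psi> where "\<psi> = A.extend (\<lambda>t. \<delta> t *\<^sub>R B.X t)"
  define \<psi>' where "\<psi>' = B.extend (\<lambda>t. inverse (\<delta> t) *\<^sub>R A.X t)"
  have lin: "linear \<psi>" "linear \<psi>'"
    unfolding \<psi>_def \<psi>'_def by (rule A.linear_extend B.linear_extend)+
  have X: "\<psi> (A.X t) = \<delta> t *\<^sub>R B.X t" "\<psi>' (B.X t) = inverse (\<delta> t) *\<^sub>R A.X t" if "t \<in> ?T" for t
    using that T by (simp_all add: \<psi>_def \<psi>'_def)
  have inv: "\<psi>' (\<psi> x) = x" for x
    by (rule A.linear_eq_on_X[of "\<lambda>x. \<psi>' (\<psi> x)" "\<lambda>x. x"])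
      (use linear_compose[OF lin] \<delta>nz in \<open>auto simp: o_def X linear_cmul[OF lin(2)] linear_iff\<close>)
  have inv': "\<psi> (\<psi>' x) = x" for x
    by (rule B.linear_eq_on_X[of "\<lambda>x. \<psi> (\<psi>' x)" "\<lambda>x. x"])
      (use linear_compose[OF lin(2,1)] \<delta>nz T in \<open>auto simp: o_def X linear_cmul[OF lin(1)] linear_iff\<close>)
  have bij: "bij \<psi>" by (rule o_bij[of \<psi>']) (auto simp: inv inv')
  have mult: "\<psi> (x * y) = \<psi> x * \<psi> y" for x y
  proof (rule A.bilinear_eq_on_X[of "\<lambda>x y. \<psi> (x * y)" "\<lambda>x y. \<psi> x * \<psi> y"])
    show "bilinear (\<lambda>x y. \<psi> (x * y))" "bilinear (\<lambda>x y. \<psi> x * \<psi> y)"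
      using lin(1) by (auto intro: A.bilinear_hom A.bilinear_comp)
    show "\<psi> (A.X s * A.X t) = \<psi> (A.X s) * \<psi> (A.X t)" if "s \<in> ?T" "t \<in> ?T" for s t
      using that A.\<sigma>_nonzero[OF that] T
      by (simp add: A.X_mult B.X_mult X linear_cmul[OF lin(1)] \<delta> mult_ac)
  qed
  \<comment> \<open>\<open>1 = \<psi> (1 * \<psi>' 1) = \<psi> 1 * \<psi> (\<psi>' 1) = \<psi>
    1\<close>.\<close>
  have one: "\<psi> 1 = 1"
    using mult[of 1 "\<psi>' 1"] by (simp add: inv')
  have "alg_iso \<psi>" unfolding alg_iso_def using lin bij one mult by blast
  moreover have "\<phi>' \<circ> \<psi> = \<psi> \<circ> \<phi>"
  proof
    fix x
    show "(\<phi>' \<circ> \<psi>) x = (\<psi> \<circ> \<phi>) x"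
    proof (rule A.linear_eq_on_X)
      show "linear (\<phi>' \<circ> \<psi>)" "linear (\<psi> \<circ> \<phi>)"
        using linear_compose \<phi>(1) \<phi>'(1) lin(1) by blast+
      fix t assume t: "t \<in> ?T"
      then show "(\<phi>' \<circ> \<psi>) (A.X t) = (\<psi> \<circ> \<phi>) (A.X t)"
        using \<phi>(2) \<phi>'(2) T
        by (simp add: A.corresponds_iff[OF \<phi>(1)] B.corresponds_iff[OF \<phi>'(1)] X
            linear_cmul[OF \<phi>'(1)] linear_cmul[OF lin(1)] mult_ac)
    qed
  qed
  moreover have "\<psi> ` \<Gamma> g = \<Gamma>' g" for g
  proof (cases "g \<in> ?T")
    case True
    have "B.X g \<in> \<Gamma>' g" using True T B.X_mem by simp
    then have "\<psi> (A.X g) \<in> \<Gamma>' g"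
      using X True B.subspace_component subspace_scale by metis
    moreover have "\<psi> (A.X g) \<noteq> 0" using X True T \<delta>nz by simp
    ultimately show ?thesis
      using True T A.image_component[OF lin(1) True] B.component_eq[of g "\<psi> (A.X g)"] by simp
  next
    case False
    then show ?thesis
      using T A.component_outside B.component_outside linear_0[OF lin(1)] by simp
  qed
  ultimately show ?thesis unfolding isomorphic_pairs_def by blast
qed

section \<open>Gradings of the complex matrix algebra\<close>

lemma mat_matrix_mult:
  fixes c :: "'b::comm_semiring_1" and M :: "'b^'n^'n::finite"
  shows "(mat c ** M) $ i $ j = c * M $ i $ j" and "(M ** mat c) $ i $ j = c * M $ i $ j"
  by (simp_all add: matrix_matrix_mult_def mat_def if_distrib[of "\<lambda>x. x * _"]
      if_distrib[of "\<lambda>x. _ * x"] mult.commute cong: if_cong)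

text \<open>Compare column \<open>q\<close> of the two products of \<open>M\<close> with the matrix
  unit at \<open>(p, q)\<close>: one shows \<open>M $ i $ p\<close>, the other
  \<open>M $ q $ q\<close> if \<open>i = p\<close> and 0 otherwise. A single arbitrary
  \<open>q\<close> suffices.\<close>

lemma central_matrix_is_scalar:
  fixes M :: "'b::comm_semiring_1^'n^'n::finite"
  assumes "\<And>N. M ** N = N ** M"
  obtains c where "M = mat c"
proof -
  define q :: 'n where "q = undefined"
  define c where "c = M $ q $ q"
  have "M $ i $ p = (if i = p then c else 0)" for i p
  proof -
    define E :: "'b^'n^'n" where "E = (\<chi> a b. if a = p \<and> b = q then 1 else 0)"
    have "(M ** E) $ i $ q = M $ i $ p"
      by (simp add: E_def matrix_matrix_mult_def if_distrib[of "\<lambda>x. _ * x"] cong: if_cong)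
    moreover have "(E ** M) $ i $ q = (if i = p then c else 0)"
      by (simp add: c_def E_def matrix_matrix_mult_def if_distrib[of "\<lambda>x. x * _"] cong: if_cong)
    ultimately show ?thesis using assms by metis
  qed
  then have "M = mat c" by (simp add: vec_eq_iff mat_def)
  then show ?thesis by (rule that)
qed

text \<open>Everything is pulled back along \<open>\<theta>\<close>: \<open>J\<close> is the
  preimage of \<open>mat \<i>\<close>, and a central element is the preimage of some
  \<open>mat c\<close>, with coefficients \<open>Re c\<close> and \<open>Im c\<close>.\<close>

lemma matrix_alg_iso_center:
  fixes \<theta> :: "'a::real_algebra_1 \<Rightarrow> complex^'n::finite^'n"
  assumes "matrix_alg_iso \<theta>"
  obtains J :: 'a where "J * J = -1" "\<And>x. J * x = x * J"
    "\<And>z :: 'a. (\<And>x. z * x = x * z) \<Longrightarrow> \<exists>a b. z = a *\<^sub>R 1 + b *\<^sub>R J"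
proof -
  have lin: "linear \<theta>" and bij: "bij \<theta>" and one: "\<theta> 1 = mat 1"
    and mult: "\<And>x y. \<theta> (x * y) = \<theta> x ** \<theta> y"
    using assms by (auto simp: matrix_alg_iso_def)
  have eqI: "x = y" if "\<theta> x = \<theta> y" for x y using that bij by (meson bij_def injD)
  obtain J where J: "\<theta> J = mat \<i>" using bij by (metis bij_pointE)
  show ?thesis
  proof (rule that[of J])
    show "J * J = -1"
      by (rule eqI) (simp add: mult J one linear_neg[OF lin] vec_eq_iff mat_matrix_mult, simp add: mat_def)
    show "J * x = x * J" for x
      by (rule eqI) (simp add: mult J vec_eq_iff mat_matrix_mult)
    fix z :: 'a assume z: "\<And>x. z * x = x * z"
    have "\<theta> z ** N = N ** \<theta> z" for N
      using z bij by (metis mult bij_pointE)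
    then obtain c where c: "\<theta> z = mat c" by (rule central_matrix_is_scalar) blast
    have "z = Re c *\<^sub>R 1 + Im c *\<^sub>R J"
    proof (rule eqI)
      have "\<theta> (Re c *\<^sub>R 1 + Im c *\<^sub>R J) = Re c *\<^sub>R mat 1 + Im c *\<^sub>R mat \<i>"
        by (simp add: linear_add[OF lin] linear_cmul[OF lin] one J)
      also have "\<dots> = mat c"
        by (auto simp: vec_eq_iff mat_def complex_eq_iff)
      finally show "\<theta> z = \<theta> (Re c *\<^sub>R 1 + Im c *\<^sub>R J)" using c by simp
    qed
    then show "\<exists>a b. z = a *\<^sub>R 1 + b *\<^sub>R J" by blast
  qed
qed

section \<open>The centre and the radical\<close>

context onedim_graded_algebra
begin

lemma central_iff: "(\<forall>x. z * x = x * z) \<longleftrightarrow> (\<forall>u\<in>T. z * X u = X u * z)"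
proof safe
  fix x assume comm: "\<forall>u\<in>T. z * X u = X u * z"
  show "z * x = x * z"
    by (rule linear_eq_on_X[of "\<lambda>x. z * x" "\<lambda>x. x * z"])
       (use comm in \<open>auto simp: linear_iff algebra_simps\<close>)
qed auto

lemma radical_iff_central:
  assumes "t \<in> T" shows "t \<in> radical T \<beta> \<longleftrightarrow> (\<forall>x. X t * x = x * X t)"
proof -
  have "X t * X u = X u * X t \<longleftrightarrow> \<beta> u t = 1" if "u \<in> T" for u
    using X_commute[OF that assms] X_mult_nonzero[OF assms that] \<beta>_eq[OF that assms, of 1] by auto
  then show ?thesis using assms by (auto simp: central_iff radical_def)
qed

text \<open>The centre is a graded subspace: moving \<open>z\<close> past \<open>X u\<close>
  multiplies its coordinate at \<open>t\<close> by \<open>\<beta> u t\<close>, so for central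
  \<open>z\<close> this factor is 1 wherever the coordinate is nonzero.\<close>

lemma coord_central:
  assumes central: "\<And>x. z * x = x * z" and t: "t \<in> T" "coord z t \<noteq> 0"
  shows "t \<in> radical T \<beta>"
proof -
  have "coord z t = coord z t * \<beta> u t" if u: "u \<in> T" for u
  proof (rule expansion_unique[OF _ t(1)])
    have "X u * (\<Sum>t\<in>T. coord z t *\<^sub>R X t) = z * X u"
      using central by (simp flip: expansion)
    also have "\<dots> = (\<Sum>t\<in>T. coord z t *\<^sub>R (X t * X u))"
      by (subst expansion) (simp add: sum_distrib_right)
    also have "\<dots> = (\<Sum>t\<in>T. (coord z t * \<beta> u t) *\<^sub>R (X u * X t))"
    proof (rule sum.cong[OF refl])
      fix t assume t: "t \<in> T"
      show "coord z t *\<^sub>R (X t * X u) = (coord z t * \<beta> u t) *\<^sub>R (X u * X t)"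
        using X_commute[OF t u] \<beta>_sym[OF t u] by simp
    qed
    also have "\<dots> = X u * (\<Sum>t\<in>T. (coord z t * \<beta> u t) *\<^sub>R X t)"
      by (simp add: sum_distrib_left)
    finally have eq: "X u * (\<Sum>t\<in>T. coord z t *\<^sub>R X t) = X u * (\<Sum>t\<in>T. (coord z t * \<beta> u t) *\<^sub>R X t)" .
    obtain y where "y * X u = 1" using invertible X_mem X_nonzero u by blast
    then have cancel: "y * (X u * x) = x" for x by (simp flip: mult.assoc)
    show "(\<Sum>t\<in>T. coord z t *\<^sub>R X t) = (\<Sum>t\<in>T. (coord z t * \<beta> u t) *\<^sub>R X t)"
      using arg_cong[OF eq, of "(*) y"] by (simp only: cancel)
  qed
  then show ?thesis using t by (simp add: radical_def)
qed

lemma type_II_exists: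
  fixes \<theta> :: "'a \<Rightarrow> complex^'n::finite^'n"
  assumes "matrix_alg_iso \<theta>"
  obtains f where "f \<noteq> 0" "radical T \<beta> = {0, f}" "\<mu> f = -1"
proof -
  obtain J :: 'a where J: "J * J = -1" "\<And>x. J * x = x * J"
    and center: "\<And>z. (\<And>x. z * x = x * z) \<Longrightarrow> \<exists>a b. z = a *\<^sub>R 1 + b *\<^sub>R J"
    using assms by (rule matrix_alg_iso_center) blast
  have J_real: "J \<noteq> r *\<^sub>R 1" for r
  proof
    assume "J = r *\<^sub>R 1"
    then have "J * J = (r * r) *\<^sub>R 1" by simp
    then have "(r * r + 1) *\<^sub>R (1 :: 'a) = J * J + 1" by (simp only: scaleR_add_left scaleR_one)
    then have "(r * r + 1) *\<^sub>R (1 :: 'a) = 0" by (simp only: J(1)) simp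
    then have "r * r + 1 = 0" by simp
    then show False using zero_le_square[of r] by linarith
  qed
  \<comment> \<open>Central elements have the form \<open>a + b J\<close>. Here
    \<open>b \<noteq> 0\<close>, as otherwise \<open>X t\<close> would lie in the component of 1,
    and the square is real only if \<open>a * b = 0\<close>. So all these \<open>X t\<close> lie on
    the line spanned by \<open>J\<close>.\<close>
  have imaginary: "\<exists>b. b \<noteq> 0 \<and> X t = b *\<^sub>R J" if t: "t \<in> radical T \<beta>" "t \<noteq> 0" for t
  proof -
    have tT: "t \<in> T" using t by (simp add: radical_def)
    obtain a b where ab: "X t = a *\<^sub>R 1 + b *\<^sub>R J"
      using center radical_iff_central[OF tT] t(1) by blast
    have "b \<noteq> 0"
    proof
      assume "b = 0"
      then have "1 *\<^sub>R X t = a *\<^sub>R X 0" using ab by simp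
      then show False using X_inj[OF tT zero_mem, of 1 a] t(2) by simp
    qed
    \<comment> \<open>Squaring \<open>a + b J\<close> gives
      \<open>2 a b J = (\<mu> t - a^2 + b^2) 1\<close>; these are the two coefficients, and
      \<open>c = 0\<close> because \<open>J\<close> is not real.\<close>
    define c d where "c = a * b + a * b" and "d = \<mu> t - a * a + b * b"
    have "\<mu> t *\<^sub>R 1 = (a *\<^sub>R 1 + b *\<^sub>R J) * (a *\<^sub>R 1 + b *\<^sub>R J)"
      using X_square[OF tT] ab by simp
    moreover have "c *\<^sub>R J = (a * b) *\<^sub>R J + (a * b) *\<^sub>R J" by (simp only: c_def scaleR_add_left)
    ultimately have cd: "c *\<^sub>R J = d *\<^sub>R 1"
      using J(1) by (simp add: d_def algebra_simps)
    have "c = 0"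
    proof (rule ccontr)
      assume "c \<noteq> 0"
      then have "J = inverse c *\<^sub>R (c *\<^sub>R J)" by simp
      also have "\<dots> = (inverse c * d) *\<^sub>R 1" by (simp add: cd)
      finally show False using J_real by simp
    qed
    then have "a = 0" using \<open>b \<noteq> 0\<close> by (simp add: c_def)
    then show ?thesis using ab \<open>b \<noteq> 0\<close> by auto
  qed
  \<comment> \<open>Not being real, \<open>J\<close> has a nonzero coordinate away from 0; since
    \<open>J\<close> is central, that index lies in the radical.\<close>
  have "\<exists>f\<in>T. f \<noteq> 0 \<and> coord J f \<noteq> 0"
  proof (rule ccontr)
    assume "\<not> ?thesis"
    then have "(\<Sum>t\<in>T. coord J t *\<^sub>R X t) = (\<Sum>t\<in>{0}. coord J t *\<^sub>R X t)"
      by (intro sum.mono_neutral_right) auto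
    then show False using J_real expansion[of J] by simp
  qed
  then obtain f where f: "f \<in> T" "f \<noteq> 0" "f \<in> radical T \<beta>" using coord_central[OF J(2)] by blast
  obtain b where b: "b \<noteq> 0" "X f = b *\<^sub>R J" using imaginary f by blast
  have "t \<in> {0, f}" if t: "t \<in> radical T \<beta>" for t
  proof (rule ccontr)
    assume "t \<notin> {0, f}"
    then obtain c where c: "c \<noteq> 0" "X t = c *\<^sub>R J" using imaginary t by blast
    have "b *\<^sub>R X t = c *\<^sub>R X f" by (simp add: b c)
    then show False using X_inj[of t f b c] t f(1) b(1) \<open>t \<notin> {0, f}\<close> by (simp add: radical_def)
  qed
  then have "radical T \<beta> = {0, f}" using f by (auto simp: radical_def)
  moreover have "\<mu> f = -1"
  proof (rule \<mu>_eq[OF f(1) _ X_mem[OF f(1)]])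
    show "X f * X f = ((b * b) * -1) *\<^sub>R 1" using b J(1) by simp
    show "0 < b * b" using b(1) by (simp add: zero_less_mult_iff) linarith
  qed simp
  ultimately show ?thesis using f(2) by (intro that)
qed

end

section \<open>Equivalence\<close>

locale type_II_grading = onedim_graded_algebra \<Gamma> k
  for \<Gamma> :: "'g::ab_group_add \<Rightarrow> 'a::real_algebra_1 set" and k +
  fixes f :: 'g
  assumes f_nonzero: "f \<noteq> 0" and radical_eq: "radical T \<beta> = {0, f}" and \<mu>_f: "\<mu> f = -1"
begin

sublocale type_II_form T k \<beta> f
  by unfold_locales (use f_nonzero radical_eq in auto)

lemma equivalent_pairs_refl: "equivalent_pairs \<Gamma> \<phi> \<Gamma> \<phi>"
  unfolding equivalent_pairs_def
  by (rule exI[of _ id]) (auto simp: alg_iso_def id_def linear_iff bij_id[unfolded id_def])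

lemma equivalent_pairs_trans:
  assumes "equivalent_pairs \<Gamma> \<phi> \<Gamma> \<phi>'" "equivalent_pairs \<Gamma> \<phi>' \<Gamma> \<phi>''"
  shows "equivalent_pairs \<Gamma> \<phi> \<Gamma> \<phi>''"
proof -
  obtain \<psi> where \<psi>: "alg_iso \<psi>" "\<phi>' \<circ> \<psi> = \<psi> \<circ> \<phi>" "\<And>g. g \<in> T \<Longrightarrow> \<exists>h. \<psi> ` \<Gamma> g = \<Gamma> h"
    using assms(1) unfolding equivalent_pairs_def by blast
  obtain \<omega> where \<omega>: "alg_iso \<omega>" "\<phi>'' \<circ> \<omega> = \<omega> \<circ> \<phi>'" "\<And>g. g \<in> T \<Longrightarrow> \<exists>h. \<omega> ` \<Gamma> g = \<Gamma> h"
    using assms(2) unfolding equivalent_pairs_def by blast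
  have "alg_iso (\<omega> \<circ> \<psi>)"
    using \<psi>(1) \<omega>(1) unfolding alg_iso_def by (auto intro: linear_compose bij_comp)
  moreover have "\<phi>'' \<circ> (\<omega> \<circ> \<psi>) = \<omega> \<circ> \<psi> \<circ> \<phi>"
    using \<psi>(2) \<omega>(2) by (metis comp_assoc)
  moreover have "\<exists>h. (\<omega> \<circ> \<psi>) ` \<Gamma> g = \<Gamma> h" if g: "g \<in> T" for g
  proof -
    obtain h where h: "\<psi> ` \<Gamma> g = \<Gamma> h" using \<psi>(3) g by blast
    \<comment> \<open>A component outside the support is zero and is mapped to itself, so both
      positions of \<open>h\<close> are covered.\<close>
    have "\<exists>h'. \<omega> ` \<Gamma> h = \<Gamma> h'"
    proof (cases "h \<in> T")
      case True
      then show ?thesis by (rule \<omega>(3))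
    next
      case False
      then show ?thesis
        using alg_isoD(1)[OF \<omega>(1)] by (intro exI[of _ h]) (simp add: component_outside linear_0)
    qed
    then show ?thesis using h by (metis image_comp)
  qed
  ultimately show ?thesis unfolding equivalent_pairs_def by blast
qed

text \<open>If \<open>\<mu> w = -1\<close>, conjugation by \<open>1 + X w\<close> induces on \<open>T\<close> the transvection that sends \<open>t\<close> to
  \<open>w + t\<close> when \<open>\<beta> w t = -1\<close> and fixes \<open>t\<close> otherwise.\<close>
definition transvection :: "'g \<Rightarrow> 'a \<Rightarrow> 'a" where
  "transvection w x = (1/2) *\<^sub>R ((1 + X w) * x * (1 - X w))"

text \<open>If \<open>X t\<close> and \<open>X w\<close> commute, the outer factors combine to
  \<open>1 - X w * X w = 2\<close>. If they anticommute, they combine to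
  \<open>(1 + X w) * (1 + X w) = 2 *\<^sub>R X w\<close>, using
  \<open>X w * X w = -1\<close>.\<close>

lemma transvection_X:
  assumes w: "w \<in> T" "\<mu> w = -1" and t: "t \<in> T"
  shows "transvection w (X t) = (if \<beta> w t = 1 then X t else X w * X t)"
proof -
  have sq: "X w * X w = -1" using X_square[OF w(1)] w(2) by simp
  have sq': "X w * (X w * x) = - x" for x using sq by (simp flip: mult.assoc)
  show ?thesis
  proof (cases "\<beta> w t = 1")
    case True
    then have c: "X t * X w = X w * X t" using X_commute[OF w(1) t] by simp
    have "(1 + X w) * X t * (1 - X w) = 2 *\<^sub>R X t"
      by (simp add: algebra_simps c sq' scaleR_2)
    with True show ?thesis by (simp add: transvection_def)
  next
    case False
    then have "\<beta> w t = -1" using \<beta>_sign[OF w(1) t] by simp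
    then have c: "X t * X w = - (X w * X t)" using X_commute[OF w(1) t] by simp
    have "(1 + X w) * X t * (1 - X w) = 2 *\<^sub>R (X w * X t)"
      by (simp add: algebra_simps c sq' scaleR_2)
    with False show ?thesis by (simp add: transvection_def)
  qed
qed

lemma alg_iso_transvection:
  assumes w: "w \<in> T" "\<mu> w = -1" shows "alg_iso (transvection w)"
proof -
  have sq: "X w * X w = -1" using X_square[OF w(1)] w(2) by simp
  \<comment> \<open>\<open>(1 + X w) * (1 - X w) = 2\<close>, so \<open>q\<close> is the inverse of
    \<open>p\<close> and the map is conjugation by \<open>p\<close>.\<close>
  define p q where "p = 1 + X w" and "q = (1/2) *\<^sub>R (1 - X w)"
  have pq: "p * q = 1" "q * p = 1"
    using sq by (simp_all add: p_def q_def algebra_simps flip: scaleR_left.add)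
  have tv: "transvection w x = p * x * q" for x by (simp add: transvection_def p_def q_def)
  have "bij (transvection w)"
    by (rule o_bij[of "\<lambda>x. q * x * p"])
       (auto simp: tv fun_eq_iff, (simp_all add: mult.assoc pq, simp_all add: pq flip: mult.assoc))
  moreover have "linear (transvection w)" by (auto simp: linear_iff tv algebra_simps)
  moreover have "transvection w (x * y) = transvection w x * transvection w y" for x y
  proof -
    have "p * x * q * (p * y * q) = p * x * (q * p) * y * q" by (simp add: mult.assoc)
    then show ?thesis by (simp add: tv pq mult.assoc)
  qed
  ultimately show ?thesis by (auto simp: alg_iso_def tv pq)
qed

text \<open>\<open>\<phi>'\<close> must act on the image of \<open>X t\<close> by
  \<open>\<eta> t\<close>. If \<open>\<beta> w t = 1\<close> this is immediate; otherwise the image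
  lies in the component of \<open>w + t\<close>, and
  \<open>\<eta>' (w + t) = \<eta> w * \<eta> t\<close>, which is where \<open>\<eta> w = 1\<close>
  enters.\<close>

lemma equivalent_pairs_transvection:
  assumes \<phi>: "\<phi> \<in> graded_involutions \<Gamma>" "corresponds \<Gamma> \<phi> \<eta>"
    and \<phi>': "\<phi>' \<in> graded_involutions \<Gamma>" "corresponds \<Gamma> \<phi>' \<eta>'"
    and \<eta>: "\<eta> \<in> quadratic_forms T \<beta>"
    and w: "w \<in> T" "\<mu> w = -1" "\<eta> w = 1" "\<And>t. t \<in> T \<Longrightarrow> \<eta>' t = \<eta> t * \<beta> w t"
  shows "equivalent_pairs \<Gamma> \<phi> \<Gamma> \<phi>'"
proof -
  let ?\<psi> = "transvection w"
  note iso = alg_iso_transvection[OF w(1,2)] and \<psi>X = transvection_X[OF w(1,2)]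
  note lin = alg_isoD(1)[OF iso] graded_involutionsD(1)[OF \<phi>(1)] graded_involutionsD(1)[OF \<phi>'(1)]
  note \<phi>X = corresponds_iff[OF lin(2), THEN iffD1, OF \<phi>(2), rule_format]
  note \<phi>'X = corresponds_iff[OF lin(3), THEN iffD1, OF \<phi>'(2), rule_format]
  have "\<phi>' \<circ> ?\<psi> = ?\<psi> \<circ> \<phi>"
  proof
    fix x
    show "(\<phi>' \<circ> ?\<psi>) x = (?\<psi> \<circ> \<phi>) x"
    proof (rule linear_eq_on_X[of "\<phi>' \<circ> ?\<psi>" "?\<psi> \<circ> \<phi>"])
      show "linear (\<phi>' \<circ> ?\<psi>)" "linear (?\<psi> \<circ> \<phi>)" using lin linear_compose by blast+
      fix t assume t: "t \<in> T"
      have "\<phi>' (?\<psi> (X t)) = \<eta> t *\<^sub>R ?\<psi> (X t)"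
      proof (cases "\<beta> w t = 1")
        case True
        then show ?thesis using t by (simp add: \<psi>X \<phi>'X w(4))
      next
        case False
        have "\<eta>' (w + t) = \<eta> t"
          using t w(1,3) by (simp add: w(4) quadratic_formsD(3)[OF \<eta>] \<beta>_add_right)
        then have "\<phi>' (X w * X t) = \<eta> t *\<^sub>R (X w * X t)"
          using t w(1) by (simp add: X_mult linear_cmul[OF lin(3)] \<phi>'X)
        then show ?thesis using t False by (simp add: \<psi>X)
      qed
      then show "(\<phi>' \<circ> ?\<psi>) (X t) = (?\<psi> \<circ> \<phi>) (X t)"
        using t by (simp add: \<phi>X linear_cmul[OF lin(1)])
    qed
  qed
  moreover have "\<exists>h. ?\<psi> ` \<Gamma> g = \<Gamma> h" if g: "g \<in> T" for g
  proof -
    define h where "h = (if \<beta> w g = 1 then g else w + g)"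
    have "h \<in> T" using g w(1) by (simp add: h_def)
    moreover have "?\<psi> (X g) \<in> \<Gamma> h"
      using g w(1) X_mem mult_component[of "X w" w "X g" g] by (simp add: \<psi>X h_def)
    moreover have "?\<psi> (X g) \<noteq> 0" using g alg_isoD(5)[OF iso] by simp
    ultimately show ?thesis
      using image_component[OF lin(1) g] component_eq[of h "?\<psi> (X g)"] by metis
  qed
  ultimately show ?thesis using iso unfolding equivalent_pairs_def by blast
qed

section \<open>Forms in the same class give equivalent pairs\<close>

lemma \<beta>_nontrivial_of_ne_\<mu>:
  assumes \<eta>: "\<eta> \<in> quadratic_forms T \<beta>" "\<eta> \<noteq> \<mu>" and u: "u \<in> T" "\<And>t. t \<in> T \<Longrightarrow> \<eta> t = \<mu> t * \<beta> u t"
  shows "\<exists>a\<in>T. \<beta> u a = -1"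
proof (rule ccontr)
  assume "\<not> ?thesis"
  then have "\<beta> u t = 1" if "t \<in> T" for t using \<beta>_sign[OF u(1) that] that by blast
  then have "\<eta> t = \<mu> t" if "t \<in> T" for t using u(2) that by simp
  then have "\<eta> = \<mu>"
    by (rule PiE_ext[OF quadratic_formsD(1)[OF \<eta>(1)] quadratic_formsD(1)[OF \<mu>_quadratic_form]])
  then show False using \<eta>(2) by simp
qed

text \<open>The forms differ by the twist with \<open>u + u'\<close>, shifted by \<open>f\<close> if
  necessary to get \<open>\<mu> w = -1\<close>. Then
  \<open>\<eta> w = \<mu> w * \<beta> u w = - \<beta> u u' = 1\<close>, so a single transvection
  suffices.\<close>

lemma equivalent_pairs_of_anticommuting:
  assumes \<phi>: "\<phi> \<in> graded_involutions \<Gamma>" "corresponds \<Gamma> \<phi> \<eta>"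
    and \<phi>': "\<phi>' \<in> graded_involutions \<Gamma>" "corresponds \<Gamma> \<phi>' \<eta>'"
    and \<eta>: "\<eta> \<in> quadratic_forms T \<beta>" and \<eta>': "\<eta>' \<in> quadratic_forms T \<beta>"
    and u: "u \<in> T" "\<And>t. t \<in> T \<Longrightarrow> \<eta> t = \<mu> t * \<beta> u t"
    and u': "u' \<in> T" "\<And>t. t \<in> T \<Longrightarrow> \<eta>' t = \<mu> t * \<beta> u' t"
    and anti: "\<beta> u u' = -1"
  shows "equivalent_pairs \<Gamma> \<phi> \<Gamma> \<phi>'"
proof -
  define v where "v = u + u'"
  define w where "w = (if \<mu> v = -1 then v else v + f)"
  have v: "v \<in> T" using u(1) u'(1) by (simp add: v_def)
  have w: "w \<in> T" using v by (simp add: w_def)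
  have \<beta>w: "\<beta> w t = \<beta> u t * \<beta> u' t" if "t \<in> T" for t
    using that u(1) u'(1) v \<beta>_add_f_left[OF v that] by (simp add: w_def) (simp add: v_def \<beta>_add_left)
  have "\<mu> (v + f) = - \<mu> v"
    using v by (simp add: quadratic_formsD(3)[OF \<mu>_quadratic_form] \<mu>_f \<beta>_f)
  then have \<mu>w: "\<mu> w = -1" using \<mu>_sign[OF v] by (auto simp: w_def)
  have "\<beta> u w = \<beta> u v"
    using v u(1) by (auto simp: w_def \<beta>_add_right \<beta>_f)
  also have "\<dots> = -1" using u(1) u'(1) anti by (simp add: v_def \<beta>_add_right)
  finally have "\<eta> w = 1" using u(2)[OF w] \<mu>w by simp
  moreover have "\<eta>' t = \<eta> t * \<beta> w t" if "t \<in> T" for t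
    using that u(1) \<beta>_square[of u t] by (simp add: u(2) u'(2) \<beta>w mult_ac)
  ultimately show ?thesis
    using equivalent_pairs_transvection[OF \<phi> \<phi>' \<eta> w \<mu>w] by blast
qed

text \<open>The kernels of \<open>\<beta> u\<close> and \<open>\<beta> u'\<close> are proper
  subgroups, and a group is not the union of two such: if neither \<open>a\<close> nor
  \<open>b\<close> avoids both kernels, then \<open>a + b\<close> does.\<close>

lemma common_anticommuting:
  assumes u: "u \<in> T" "u' \<in> T" and "\<exists>a\<in>T. \<beta> u a = -1" "\<exists>b\<in>T. \<beta> u' b = -1"
  obtains v where "v \<in> T" "\<beta> u v = -1" "\<beta> u' v = -1"
proof -
  obtain a b where a: "a \<in> T" "\<beta> u a = -1" and b: "b \<in> T" "\<beta> u' b = -1"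
    using assms by blast
  consider "\<beta> u' a = -1" | "\<beta> u b = -1" | "\<beta> u' a = 1" "\<beta> u b = 1"
    using \<beta>_sign[OF u(2) a(1)] \<beta>_sign[OF u(1) b(1)] by blast
  then show ?thesis
  proof cases
    case 3
    then show ?thesis using that[of "a + b"] a b u by (simp add: \<beta>_add_right)
  qed (use that a b in blast)+
qed

theorem equivalent_pairs_if:
  assumes \<phi>: "\<phi> \<in> graded_involutions \<Gamma>" "corresponds \<Gamma> \<phi> \<eta>"
    and \<phi>': "\<phi>' \<in> graded_involutions \<Gamma>" "corresponds \<Gamma> \<phi>' \<eta>'"
    and \<eta>: "\<eta> \<in> form_class T \<beta> \<mu> i" and \<eta>': "\<eta>' \<in> form_class T \<beta> \<mu> i"
  shows "equivalent_pairs \<Gamma> \<phi> \<Gamma> \<phi>'"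
proof -
  have Q: "\<eta> \<in> quadratic_forms T \<beta>" "\<eta>' \<in> quadratic_forms T \<beta>"
    using \<eta> \<eta>' by (auto simp: form_class_def)
  consider "\<eta> = \<mu>" "\<eta>' = \<mu>" | "\<eta> f = -1" "\<eta> \<noteq> \<mu>" "\<eta>' f = -1" "\<eta>' \<noteq> \<mu>"
    | "\<eta> f = 1" "\<eta>' f = 1" "Arf T \<eta>' = Arf T \<eta>"
    using \<eta> \<eta>' by (auto simp: form_class_def rad_elt_eq)
  then show ?thesis
  proof cases
    case 1
    then have "\<phi> = \<phi>'"
      using corresponding_involution_unique graded_involutionsD(1) \<phi> \<phi>' by blast
    then show ?thesis by (simp add: equivalent_pairs_refl)
  next
    case 2
    then have eq_f: "\<mu> f = \<eta> f" "\<mu> f = \<eta>' f" using \<mu>_f by simp_all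
    obtain u where u: "u \<in> T" "\<And>t. t \<in> T \<Longrightarrow> \<eta> t = \<mu> t * \<beta> u t"
      using quadratic_forms_differ[OF \<mu>_quadratic_form \<mu>_f \<mu>_quadratic_form Q(1) eq_f(1)] by metis
    obtain u' where u': "u' \<in> T" "\<And>t. t \<in> T \<Longrightarrow> \<eta>' t = \<mu> t * \<beta> u' t"
      using quadratic_forms_differ[OF \<mu>_quadratic_form \<mu>_f \<mu>_quadratic_form Q(2) eq_f(2)] by metis
    obtain v where v: "v \<in> T" "\<beta> u v = -1" "\<beta> u' v = -1"
      using common_anticommuting[OF u(1) u'(1)]
        \<beta>_nontrivial_of_ne_\<mu>[OF Q(1) 2(2) u] \<beta>_nontrivial_of_ne_\<mu>[OF Q(2) 2(4) u'] by blast
    \<comment> \<open>\<open>\<beta> u u'\<close> may be 1, so the path goes through the form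
      attached to \<open>v\<close>, where \<open>X v\<close> anticommutes with both
      \<open>X u\<close> and \<open>X u'\<close>.\<close>
    define \<zeta> where "\<zeta> = (\<lambda>t\<in>T. \<mu> t * \<beta> v t)"
    have \<zeta>: "\<zeta> \<in> quadratic_forms T \<beta>" "\<And>t. t \<in> T \<Longrightarrow> \<zeta> t = \<mu> t * \<beta> v t"
      unfolding \<zeta>_def using quadratic_forms_twist[OF \<mu>_quadratic_form character_\<beta>[OF v(1)]] by auto
    obtain \<phi>'' where \<phi>'': "\<phi>'' \<in> graded_involutions \<Gamma>" "corresponds \<Gamma> \<phi>'' \<zeta>"
      using \<zeta>(1) by (rule form_involution_exists)
    have "equivalent_pairs \<Gamma> \<phi> \<Gamma> \<phi>''"
      using equivalent_pairs_of_anticommuting[OF \<phi> \<phi>'' Q(1) \<zeta>(1) u v(1) \<zeta>(2) v(2)] by blast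
    moreover have "\<beta> v u' = -1" using v \<beta>_sym[OF v(1) u'(1)] by simp
    then have "equivalent_pairs \<Gamma> \<phi>'' \<Gamma> \<phi>'"
      using equivalent_pairs_of_anticommuting[OF \<phi>'' \<phi>' \<zeta>(1) Q(2) v(1) \<zeta>(2) u'] by blast
    ultimately show ?thesis by (rule equivalent_pairs_trans)
  next
    case 3
    then have "\<eta> f = \<eta>' f" by simp
    then obtain w where w: "w \<in> T" "\<mu> w = -1" "\<And>t. t \<in> T \<Longrightarrow> \<eta>' t = \<eta> t * \<beta> w t"
      using quadratic_forms_differ[OF \<mu>_quadratic_form \<mu>_f Q] by metis
    \<comment> \<open>Equality of the Arf invariants supplies the condition that the transvection
      requires.\<close>
    have "\<eta> w = 1" using eq_one_of_Arf_eq[OF Q w(1,3) 3(1,3)] by blast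
    then show ?thesis
      using equivalent_pairs_transvection[OF \<phi> \<phi>' Q(1) w(1,2)] w(3) by blast
  qed
qed

section \<open>Invariants of equivalence and the four classes\<close>

text \<open>\<open>\<psi>\<close> permutes the components and \<open>\<alpha>\<close> records this
  on \<open>T\<close>. Squares and eigenvalues are preserved, and \<open>f\<close> is fixed as the
  only nonzero index whose component is central.\<close>

lemma equivalent_pairs_permutation:
  assumes \<phi>: "\<phi> \<in> graded_involutions \<Gamma>" "corresponds \<Gamma> \<phi> \<eta>"
    and \<phi>': "\<phi>' \<in> graded_involutions \<Gamma>" "corresponds \<Gamma> \<phi>' \<eta>'"
    and eq: "equivalent_pairs \<Gamma> \<phi> \<Gamma> \<phi>'"
  obtains \<alpha> where "bij_betw \<alpha> T T" "\<alpha> f = f"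
    "\<And>t. t \<in> T \<Longrightarrow> \<mu> (\<alpha> t) = \<mu> t" "\<And>t. t \<in> T \<Longrightarrow> \<eta>' (\<alpha> t) = \<eta> t"
proof -
  obtain \<psi> where \<psi>: "alg_iso \<psi>" "\<phi>' \<circ> \<psi> = \<psi> \<circ> \<phi>" "\<And>g. g \<in> T \<Longrightarrow> \<exists>h. \<psi> ` \<Gamma> g = \<Gamma> h"
    using eq unfolding equivalent_pairs_def by blast
  note \<psi>D = alg_isoD[OF \<psi>(1)]
  obtain \<alpha> where \<alpha>: "\<And>g. g \<in> T \<Longrightarrow> \<psi> ` \<Gamma> g = \<Gamma> (\<alpha> g)" using \<psi>(3) by metis
  have mem: "\<psi> (X t) \<in> \<Gamma> (\<alpha> t)" "\<psi> (X t) \<noteq> 0" if "t \<in> T" for t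
    using \<alpha> X_mem that \<psi>D(5) by auto
  have \<alpha>T: "\<alpha> t \<in> T" if "t \<in> T" for t
    using mem[OF that] component_outside by blast
  have inj: "inj_on \<alpha> T"
  proof (rule inj_onI)
    fix s t assume st: "s \<in> T" "t \<in> T" "\<alpha> s = \<alpha> t"
    then have "\<Gamma> s = \<Gamma> t" using \<alpha> \<psi>D(2) by (metis bij_def inj_image_eq_iff)
    then show "s = t" using component_disjoint X_mem X_nonzero st by metis
  qed
  then have bij: "bij_betw \<alpha> T T"
    using \<alpha>T by (simp add: bij_betw_def endo_inj_surj image_subsetI)
  have "\<alpha> 0 = 0"
    using mem(1)[OF zero_mem] \<psi>D(3) one_component component_disjoint by (metis X_zero zero_neq_one)
  moreover have "\<alpha> f \<in> radical T \<beta>"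
  proof -
    have "X f * x = x * X f" for x
      using radical_iff_central[OF f_mem] radical_eq by blast
    then have central: "\<psi> (X f) * y = y * \<psi> (X f)" for y
      using \<psi>D(2,4) by (metis bij_pointE)
    have "\<Gamma> (\<alpha> f) = range (\<lambda>r. r *\<^sub>R \<psi> (X f))"
      using component_eq[OF \<alpha>T[OF f_mem]] mem[OF f_mem] by simp
    then obtain r where "X (\<alpha> f) = r *\<^sub>R \<psi> (X f)" using X_mem[OF \<alpha>T[OF f_mem]] by auto
    then show ?thesis using radical_iff_central[OF \<alpha>T[OF f_mem]] central by simp
  qed
  ultimately have "\<alpha> f = f"
    using inj f_nonzero unfolding radical_eq by (metis f_mem inj_onD insertE singletonD zero_mem)
  moreover have "\<mu> (\<alpha> t) = \<mu> t" if "t \<in> T" for t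
  proof (rule \<mu>_eq)
    show "\<psi> (X t) * \<psi> (X t) = (1 * \<mu> t) *\<^sub>R 1"
      using that \<psi>D by (simp add: X_square linear_cmul flip: \<psi>D(4))
  qed (use that \<alpha>T \<mu>_sign mem in auto)
  moreover have "\<eta>' (\<alpha> t) = \<eta> t" if "t \<in> T" for t
  proof -
    have "\<eta>' (\<alpha> t) *\<^sub>R \<psi> (X t) = \<phi>' (\<psi> (X t))"
      using \<phi>'(2) mem(1)[OF that] \<alpha>T[OF that] by (simp add: corresponds_def)
    also have "\<dots> = \<psi> (\<phi> (X t))" using \<psi>(2) by (metis o_apply)
    also have "\<dots> = \<eta> t *\<^sub>R \<psi> (X t)"
      using that \<phi>(2) X_mem linear_cmul[OF \<psi>D(1)] by (simp add: corresponds_def)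
    finally show ?thesis using mem(2)[OF that] by simp
  qed
  ultimately show ?thesis using bij by (intro that)
qed

text \<open>The only possible gap is a form with \<open>\<eta> f = 1\<close> and Arf invariant 0,
  which the Gauss sum excludes.\<close>

lemma form_classes_cover:
  assumes \<eta>: "\<eta> \<in> quadratic_forms T \<beta>"
  obtains i where "i \<in> {1..4}" "\<eta> \<in> form_class T \<beta> \<mu> i"
proof -
  have "\<eta> f = 1 \<or> \<eta> f = -1" using quadratic_formsD(2)[OF \<eta> f_mem] by blast
  then show ?thesis
    using that[of 1] that[of 2] that[of 3] that[of 4] Arf_sign[OF \<eta>] \<eta>
    by (auto simp: form_class_def rad_elt_eq)
qed

text \<open>The classes are cut out by the value at \<open>f\<close>, equality with
  \<open>\<mu>\<close> and the Arf invariant. All three survive the permutation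
  \<open>\<alpha>\<close>, which fixes \<open>f\<close>, preserves \<open>\<mu>\<close> and carries
  \<open>\<eta>\<close> to \<open>\<eta>'\<close>.\<close>

theorem equivalent_pairs_only_if:
  assumes \<phi>: "\<phi> \<in> graded_involutions \<Gamma>" "corresponds \<Gamma> \<phi> \<eta>"
    and \<phi>': "\<phi>' \<in> graded_involutions \<Gamma>" "corresponds \<Gamma> \<phi>' \<eta>'"
    and \<eta>: "\<eta> \<in> form_class T \<beta> \<mu> i" and \<eta>': "\<eta>' \<in> quadratic_forms T \<beta>"
    and eq: "equivalent_pairs \<Gamma> \<phi> \<Gamma> \<phi>'"
  shows "\<eta>' \<in> form_class T \<beta> \<mu> i"
proof -
  have Q: "\<eta> \<in> quadratic_forms T \<beta>" using \<eta> by (simp add: form_class_def)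
  obtain \<alpha> where bij: "bij_betw \<alpha> T T" and f: "\<alpha> f = f"
    and \<mu>: "\<And>t. t \<in> T \<Longrightarrow> \<mu> (\<alpha> t) = \<mu> t" and \<alpha>: "\<And>t. t \<in> T \<Longrightarrow> \<eta>' (\<alpha> t) = \<eta> t"
    using \<phi> \<phi>' eq by (rule equivalent_pairs_permutation) blast
  have "\<eta>' f = \<eta> f" using \<alpha>[OF f_mem] f by simp
  moreover have "\<eta>' = \<mu> \<longleftrightarrow> \<eta> = \<mu>"
  proof -
    have ext: "\<zeta> = \<mu> \<longleftrightarrow> (\<forall>t\<in>T. \<zeta> t = \<mu> t)" if "\<zeta> \<in> quadratic_forms T \<beta>" for \<zeta>
      using PiE_ext[OF quadratic_formsD(1)[OF that] quadratic_formsD(1)[OF \<mu>_quadratic_form]] by blast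
    have "(\<forall>t\<in>T. \<eta>' t = \<mu> t) \<longleftrightarrow> (\<forall>t\<in>T. \<eta>' (\<alpha> t) = \<mu> (\<alpha> t))"
      using bij unfolding bij_betw_def by (metis image_iff)
    then show ?thesis using \<mu> \<alpha> ext Q \<eta>' by simp
  qed
  moreover have "Arf T \<eta>' = Arf T \<eta>"
  proof -
    have "sum \<eta> T = sum \<eta>' T"
      using sum.reindex_bij_betw[OF bij, of \<eta>'] \<alpha> by simp
    then have "real_of_int (Arf T \<eta>') = real_of_int (Arf T \<eta>)"
      using Arf_eq_sgn_sum[of T] quadratic_formsD(2)[OF Q] quadratic_formsD(2)[OF \<eta>'] by simp
    then show ?thesis by simp
  qed
  ultimately show ?thesis using \<eta> \<eta>' by (simp add: form_class_def rad_elt_eq)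
qed

lemma form_classes_union: "(\<Union>i\<in>{1..4}. form_class T \<beta> \<mu> i) = quadratic_forms T \<beta>"
proof
  show "quadratic_forms T \<beta> \<subseteq> (\<Union>i\<in>{1..4}. form_class T \<beta> \<mu> i)"
    using form_classes_cover by blast
qed (auto simp: form_class_def)

text \<open>\<open>\<mu> f = -1\<close> keeps the first class apart from the last two. Indices
  outside 1 to 4 give empty classes, so any index set \<open>S\<close> is allowed.\<close>

lemma form_classes_disjoint: "disjoint_family_on (form_class T \<beta> \<mu>) S"
  unfolding disjoint_family_on_def form_class_def using \<mu>_f by (auto simp: rad_elt_eq)

lemma type_II_radical: "type_II T \<beta>"
  using f_nonzero by (simp add: type_II_def radical_eq)

lemma equivalent_pairs_iff:
  assumes \<phi>: "\<phi> \<in> graded_involutions \<Gamma>" "corresponds \<Gamma> \<phi> \<eta>"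
    and \<phi>': "\<phi>' \<in> graded_involutions \<Gamma>" "corresponds \<Gamma> \<phi>' \<eta>'"
    and \<eta>: "\<eta> \<in> quadratic_forms T \<beta>" "\<eta>' \<in> quadratic_forms T \<beta>"
  shows "equivalent_pairs \<Gamma> \<phi> \<Gamma> \<phi>' \<longleftrightarrow>
    (\<exists>i\<in>{1..4}. \<eta> \<in> form_class T \<beta> \<mu> i \<and> \<eta>' \<in> form_class T \<beta> \<mu> i)"
  using equivalent_pairs_if[OF \<phi> \<phi>'] equivalent_pairs_only_if[OF \<phi> \<phi>' _ \<eta>(2)]
    form_classes_cover[OF \<eta>(1)] by metis

end

text \<open>The bijection is expressed by unique existence in both directions. The isomorphism
  clause compares pairs on two matrix algebras whose types may differ; equality of supports is
  listed because the forms are functions on the support.\<close>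

theorem mainTheorem8:
  fixes m :: nat
    and \<Gamma> :: "'g::ab_group_add \<Rightarrow> 'a::real_algebra_1 set"
    and T :: "'g set" and \<beta> :: "'g \<Rightarrow> 'g \<Rightarrow> real" and \<mu> :: "'g \<Rightarrow> real"
  assumes "CARD('n::finite) = 2 ^ m"
    and "\<exists>\<theta> :: 'a \<Rightarrow> complex^'n^'n. matrix_alg_iso \<theta>"
    and "onedim_division_grading (2 * m + 1) \<Gamma>"
    and "T = support \<Gamma>" and "\<beta> = grading_beta \<Gamma>" and "\<mu> = grading_mu \<Gamma>"
  shows
    "((\<forall>u\<in>T. \<forall>v\<in>T. \<forall>X\<in>\<Gamma> u - {0}. \<forall>Y\<in>\<Gamma> v - {0}. X * Y = \<beta> u v *\<^sub>R (Y * X)) \<and>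
     (\<forall>t\<in>T. \<forall>X\<in>\<Gamma> t - {0}. \<exists>c>0. X * X = c *\<^sub>R (\<mu> t *\<^sub>R 1)) \<and>
     alternating_bicharacter T \<beta> \<and> type_II T \<beta> \<and>
     \<mu> \<in> quadratic_forms T \<beta> \<and> \<mu> (rad_elt T \<beta>) = -1) \<and>
     ((\<forall>\<phi>\<in>graded_involutions \<Gamma>. \<exists>!\<eta>. \<eta> \<in> quadratic_forms T \<beta> \<and> corresponds \<Gamma> \<phi> \<eta>) \<and>
     (\<forall>\<eta>\<in>quadratic_forms T \<beta>. \<exists>!\<phi>. \<phi> \<in> graded_involutions \<Gamma> \<and> corresponds \<Gamma> \<phi> \<eta>)) \<and>
     (\<forall>(\<Gamma>' :: 'g \<Rightarrow> 'b::real_algebra_1 set) \<phi> \<phi>' \<eta> \<eta>'.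
       (\<exists>\<theta> :: 'b \<Rightarrow> complex^'n^'n. matrix_alg_iso \<theta>) \<longrightarrow>
       onedim_division_grading (2 * m + 1) \<Gamma>' \<longrightarrow>
       \<phi> \<in> graded_involutions \<Gamma> \<longrightarrow> \<phi>' \<in> graded_involutions \<Gamma>' \<longrightarrow>
       \<eta> \<in> quadratic_forms T \<beta> \<longrightarrow> corresponds \<Gamma> \<phi> \<eta> \<longrightarrow>
       \<eta>' \<in> quadratic_forms (support \<Gamma>') (grading_beta \<Gamma>') \<longrightarrow> corresponds \<Gamma>' \<phi>' \<eta>' \<longrightarrow>
       (isomorphic_pairs \<Gamma> \<phi> \<Gamma>' \<phi>' \<longleftrightarrow>
        support \<Gamma>' = T \<and> grading_mu \<Gamma>' = \<mu> \<and> \<eta>' = \<eta>)) \<and>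
     (card (quadratic_forms T \<beta>) = 2 ^ (2 * m + 1) \<and>
     (\<Union>i\<in>{1..4}. form_class T \<beta> \<mu> i) = quadratic_forms T \<beta> \<and>
     disjoint_family_on (form_class T \<beta> \<mu>) {1..4}) \<and>
     (\<forall>\<phi>\<in>graded_involutions \<Gamma>. \<forall>\<phi>'\<in>graded_involutions \<Gamma>.
       \<forall>\<eta>\<in>quadratic_forms T \<beta>. \<forall>\<eta>'\<in>quadratic_forms T \<beta>.
       corresponds \<Gamma> \<phi> \<eta> \<longrightarrow> corresponds \<Gamma> \<phi>' \<eta>' \<longrightarrow>
       (equivalent_pairs \<Gamma> \<phi> \<Gamma> \<phi>' \<longleftrightarrow>
        (\<exists>i\<in>{1..4}. \<eta> \<in> form_class T \<beta> \<mu> i \<and> \<eta>' \<in> form_class T \<beta> \<mu> i)))"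
proof -
  interpret onedim_graded_algebra \<Gamma> "2 * m + 1" by unfold_locales (rule assms(3))
  obtain \<theta> :: "'a \<Rightarrow> complex^'n^'n" where \<theta>: "matrix_alg_iso \<theta>" using assms(2) by blast
  obtain f where f: "f \<noteq> 0" "radical T \<beta> = {0, f}" "\<mu> f = -1"
    using type_II_exists[OF \<theta>] assms(4-6) by metis
  interpret G: type_II_grading \<Gamma> "2 * m + 1" f
    by unfold_locales (use f assms(4-6) in auto)
  have commutation: "\<forall>u\<in>T. \<forall>v\<in>T. \<forall>x\<in>\<Gamma> u - {0}. \<forall>y\<in>\<Gamma> v - {0}. x * y = \<beta> u v *\<^sub>R (y * x)"
    unfolding assms(4,5) using component_commute by blast
  have squares: "\<forall>t\<in>T. \<forall>x\<in>\<Gamma> t - {0}. \<exists>c>0. x * x = c *\<^sub>R (\<mu> t *\<^sub>R 1)"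
    unfolding assms(4,6) using component_square by blast
  have forms: "alternating_bicharacter T \<beta>" "type_II T \<beta>" "\<mu> \<in> quadratic_forms T \<beta>"
    "\<mu> (rad_elt T \<beta>) = -1"
    unfolding assms(4-6)
    by (simp_all only: alternating_bicharacter_\<beta> G.type_II_radical \<mu>_quadratic_form G.rad_elt_eq G.\<mu>_f)
  have form: "\<exists>!\<eta>. \<eta> \<in> quadratic_forms T \<beta> \<and> corresponds \<Gamma> \<phi> \<eta>"
    if \<phi>: "\<phi> \<in> graded_involutions \<Gamma>" for \<phi>
  proof -
    obtain \<eta> where "\<eta> \<in> quadratic_forms T \<beta>" "corresponds \<Gamma> \<phi> \<eta>"
      unfolding assms(4,5) using \<phi> by (rule involution_form_exists)
    then show ?thesis
      using corresponding_form_unique[OF graded_involutionsD(1)[OF \<phi>]] unfolding assms(4,5) by blast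
  qed
  have involution: "\<exists>!\<phi>. \<phi> \<in> graded_involutions \<Gamma> \<and> corresponds \<Gamma> \<phi> \<eta>"
    if \<eta>: "\<eta> \<in> quadratic_forms T \<beta>" for \<eta>
  proof -
    obtain \<phi> where "\<phi> \<in> graded_involutions \<Gamma>" "corresponds \<Gamma> \<phi> \<eta>"
      using \<eta>[unfolded assms(4,5)] by (rule form_involution_exists)
    then show ?thesis
      using corresponding_involution_unique graded_involutionsD(1) by blast
  qed
  have isomorphism: "isomorphic_pairs \<Gamma> \<phi> \<Gamma>' \<phi>' \<longleftrightarrow>
      support \<Gamma>' = T \<and> grading_mu \<Gamma>' = \<mu> \<and> \<eta>' = \<eta>"
    if "onedim_division_grading (2 * m + 1) \<Gamma>'"
      "\<phi> \<in> graded_involutions \<Gamma>" "\<phi>' \<in> graded_involutions \<Gamma>'"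
      "\<eta> \<in> quadratic_forms T \<beta>" "corresponds \<Gamma> \<phi> \<eta>"
      "\<eta>' \<in> quadratic_forms (support \<Gamma>') (grading_beta \<Gamma>')" "corresponds \<Gamma>' \<phi>' \<eta>'"
    for \<Gamma>' :: "'g \<Rightarrow> 'b set" and \<phi> \<phi>' \<eta> \<eta>'
  proof -
    interpret B: onedim_graded_algebra \<Gamma>' "2 * m + 1" by unfold_locales (rule that(1))
    note lin = graded_involutionsD(1)[OF that(2)] B.graded_involutionsD(1)[OF that(3)]
    show ?thesis
      using isomorphic_pairs_imp[OF assms(3) that(1) lin(1) that(5) that(4)[unfolded assms(4,5)]
          lin(2) that(7,6)]
        isomorphic_pairs_of_forms_eq[OF assms(3) that(1) _ _ lin(1) that(5) lin(2)] that(7)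
      unfolding assms(4,6) by blast
  qed
  have classes: "card (quadratic_forms T \<beta>) = 2 ^ (2 * m + 1)"
    "(\<Union>i\<in>{1..4}. form_class T \<beta> \<mu> i) = quadratic_forms T \<beta>"
    "disjoint_family_on (form_class T \<beta> \<mu>) {1..4}"
    unfolding assms(4-6)
    by (rule card_quadratic_forms[OF \<mu>_quadratic_form] G.form_classes_union G.form_classes_disjoint)+
  have equivalence: "equivalent_pairs \<Gamma> \<phi> \<Gamma> \<phi>' \<longleftrightarrow>
      (\<exists>i\<in>{1..4}. \<eta> \<in> form_class T \<beta> \<mu> i \<and> \<eta>' \<in> form_class T \<beta> \<mu> i)"
    if "\<phi> \<in> graded_involutions \<Gamma>" "\<phi>' \<in> graded_involutions \<Gamma>"
      "\<eta> \<in> quadratic_forms T \<beta>" "\<eta>' \<in> quadratic_forms T \<beta>"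
      "corresponds \<Gamma> \<phi> \<eta>" "corresponds \<Gamma> \<phi>' \<eta>'" for \<phi> \<phi>' \<eta> \<eta>'
    using G.equivalent_pairs_iff[OF that(1,5,2,6)] that(3,4) unfolding assms(4-6) by blast
  show ?thesis
    by (intro conjI ballI allI impI commutation[rule_format] squares[rule_format] forms form
        involution isomorphism classes equivalence)
qed

end
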